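(* Let $n\ge2$, let $R$ be the root system of $\mathfrak{sl}_n(\mathbb C)$, $\mathfrak h$ its Cartan subalgebra, $l=n-1$ its rank, and $W=S_n$ its Weyl group acting on $\mathfrak h$. Then the following identity of formal power series in $q,t$ holds: $$\frac{(1-qt)^{l}}{(1-q)^{l}(1-t)^{l}}\ \mathrm{CT}\left\{\prod_{\alpha\in R}\frac{(1-qt\,e^{\alpha})(1-e^{\alpha})}{(1-q\,e^{\alpha})(1-t\,e^{\alpha})}\right\}=\sum_{w\in W}\frac{\det(1-qt\,w)}{\det(1-q\,w)\det(1-t\,w)}.$$
   Context: Let $Q$ be the root lattice of $R$ and $\mathbb Z[Q]$ its group ring, with $e^\alpha\in\mathbb Z[Q]$ the element corresponding to $\alpha\in R$. $\mathrm{CT}:\mathbb Z[Q][[q,t]]\to\mathbb Z[[q,t]]$ takes the coefficient of $e^0$ coefficientwise in $q,t$ (rational functions being expanded as power series in $q,t$). The determinants on the right are taken in the natural reflection representation of $W$ on $\mathfrak h$ (of dimension $l=n-1$). *)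

theory Defs
  imports
    "HOL-Computational_Algebra.Formal_Power_Series"
    "HOL-Combinatorics.Permutations"
    "HOL-Library.Poly_Mapping"
    "Jordan_Normal_Form.Determinant"
begin

section \<open>Formal power series in two variables\<close>

text \<open>The ring of power series in \<open>q\<close> and \<open>t\<close> over \<open>A\<close> is the iterated ring \<open>A[[q]][[t]]\<close>:
  the coefficient of \<open>q^i t^j\<close> in \<open>F\<close> is \<open>fps_nth (fps_nth F j) i\<close>.\<close>

type_synonym 'a fps2 = "'a fps fps"

definition coeff2 :: "'a fps2 \<Rightarrow> nat \<Rightarrow> nat \<Rightarrow> 'a" where
  "coeff2 F i j = fps_nth (fps_nth F j) i"

definition qvar :: "'a::comm_ring_1 fps2" where
  "qvar = fps_const fps_X"

definition tvar :: "'a::comm_ring_1 fps2" where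
  "tvar = fps_X"

definition const2 :: "'a::comm_ring_1 \<Rightarrow> 'a fps2" where
  "const2 a = fps_const (fps_const a)"

text \<open>Power series expansion of the fraction \<open>A / B\<close>, where \<open>B\<close> has constant coefficient \<open>1\<close>.
  The coefficient rings below (the integers, a group ring) are not fields, so division of
  power series from the library is not available; lemma \<open>quot2_unique\<close> shows that
  \<open>quot2 A B\<close> is the only power series \<open>F\<close> with \<open>F * B = A\<close>.\<close>

definition quot2 :: "'a::comm_ring_1 fps2 \<Rightarrow> 'a fps2 \<Rightarrow> 'a fps2" where
  "quot2 A B = A * fps_right_inverse B (fps_right_inverse (fps_nth B 0) 1)"

lemma quot2_unique:
  assumes "coeff2 B 0 0 = 1"
  shows "F * B = A \<longleftrightarrow> F = quot2 A B"
proof -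
  have "fps_nth B 0 * fps_right_inverse (fps_nth B 0) 1 = 1"
    by (rule fps_right_inverse) (use assms in \<open>simp add: coeff2_def\<close>)
  then have inv: "B * fps_right_inverse B (fps_right_inverse (fps_nth B 0) 1) = 1"
    by (rule fps_right_inverse)
  show ?thesis
  proof
    assume "F * B = A"
    then show "F = quot2 A B"
      unfolding quot2_def using inv by (metis mult.assoc mult.right_neutral)
  next
    assume "F = quot2 A B"
    then show "F * B = A"
      unfolding quot2_def using inv by (metis mult.assoc mult.commute mult.right_neutral)
  qed
qed

section \<open>Roots and the constant term\<close>

text \<open>Weights are written in the basis \<open>\<epsilon>\<^sub>0, \<dots>, \<epsilon>\<^sub>n\<^sub>-\<^sub>1\<close>, with \<open>\<epsilon>\<^sub>i\<close> represented
  by \<open>Poly_Mapping.single i 1\<close>, so that the roots of \<open>sl\<^sub>n\<close> are \<open>\<epsilon>\<^sub>i - \<epsilon>\<^sub>j\<close> for \<open>i \<noteq> j\<close>.\<close>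

type_synonym weight = "nat \<Rightarrow>\<^sub>0 int"

definition root_system :: "nat \<Rightarrow> weight set" where
  "root_system n =
     {Poly_Mapping.single i 1 - Poly_Mapping.single j 1 | i j. i < n \<and> j < n \<and> i \<noteq> j}"

lemma finite_root_system: "finite (root_system n)"
proof (rule finite_subset)
  show "root_system n \<subseteq> (\<lambda>(i, j). Poly_Mapping.single i 1 - Poly_Mapping.single j 1) ` ({..<n} \<times> {..<n})"
    by (auto simp: root_system_def)
qed simp

inductive_set root_lattice :: "nat \<Rightarrow> weight set" for n where
  root_lattice_zero: "0 \<in> root_lattice n"
| root_lattice_root: "\<alpha> \<in> root_system n \<Longrightarrow> \<alpha> \<in> root_lattice n"
| root_lattice_diff: "\<alpha> \<in> root_lattice n \<Longrightarrow> \<beta> \<in> root_lattice n \<Longrightarrow> \<alpha> - \<beta> \<in> root_lattice n"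

text \<open>With the convolution product, \<open>weight \<Rightarrow>\<^sub>0 int\<close> is the group ring of the ambient lattice
  of all weights; \<open>\<int>[Q]\<close> is its subring of elements supported on the root lattice.
  Power series are taken over the ambient group ring; the integrand of interest has all its
  coefficients in \<open>\<int>[Q]\<close>: see \<open>integrand_in_root_group_ring\<close>.\<close>

definition root_group_ring :: "nat \<Rightarrow> (weight \<Rightarrow>\<^sub>0 int) set" where
  "root_group_ring n = {f. Poly_Mapping.keys f \<subseteq> root_lattice n}"

definition e_exp :: "weight \<Rightarrow> (weight \<Rightarrow>\<^sub>0 int) fps2" where
  "e_exp \<alpha> = const2 (Poly_Mapping.single \<alpha> 1)"

definition CT :: "(weight \<Rightarrow>\<^sub>0 int) fps2 \<Rightarrow> int fps2" where
  "CT F = Abs_fps (\<lambda>j. Abs_fps (\<lambda>i. Poly_Mapping.lookup (coeff2 F i j) 0))"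

section \<open>The reflection representation\<close>

definition cartan :: "nat \<Rightarrow> complex mat set" where
  "cartan n = {H \<in> carrier_mat n n. diagonal_mat H \<and> (\<Sum>a<n. H $$ (a, a)) = 0}"

definition weyl_group :: "nat \<Rightarrow> (nat \<Rightarrow> nat) set" where
  "weyl_group n = {w. w permutes {..<n}}"

text \<open>Conjugation by the permutation matrix of \<open>w\<close>; on \<open>cartan n\<close> it moves the diagonal
  entry in position \<open>a\<close> to position \<open>w a\<close>.\<close>

definition weyl_act :: "nat \<Rightarrow> (nat \<Rightarrow> nat) \<Rightarrow> complex mat \<Rightarrow> complex mat" where
  "weyl_act n w H = mat n n (\<lambda>(a, b). H $$ (Hilbert_Choice.inv w a, Hilbert_Choice.inv w b))"

definition simple_coroot :: "nat \<Rightarrow> nat \<Rightarrow> complex mat" where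
  "simple_coroot n i = mat n n (\<lambda>(a, b).
     if a = b \<and> a = i then 1 else if a = b \<and> a = Suc i then -1 else 0)"

definition coroot_comb :: "nat \<Rightarrow> (nat \<Rightarrow> complex) \<Rightarrow> complex mat" where
  "coroot_comb n c = mat n n (\<lambda>(a, b). \<Sum>j<n - 1. c j * simple_coroot n j $$ (a, b))"

text \<open>The matrix of \<open>w\<close> acting on \<open>cartan n\<close> in the basis of simple coroots.  Its entries are
  integers because \<open>w\<close> preserves the coroot lattice; this is why the determinants
  below are power series with integer coefficients.\<close>

definition refl_mat :: "nat \<Rightarrow> (nat \<Rightarrow> nat) \<Rightarrow> int mat" where
  "refl_mat n w = (THE A. A \<in> carrier_mat (n - 1) (n - 1) \<and>
     (\<forall>i<n - 1. weyl_act n w (simple_coroot n i) = coroot_comb n (\<lambda>j. of_int (A $$ (j, i)))))"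

text \<open>\<open>det (1 - z w)\<close> on the reflection representation.\<close>

definition refl_det :: "nat \<Rightarrow> int fps2 \<Rightarrow> (nat \<Rightarrow> nat) \<Rightarrow> int fps2" where
  "refl_det n z w = det (1\<^sub>m (n - 1) - z \<cdot>\<^sub>m map_mat const2 (refl_mat n w))"

subsection \<open>The simple coroots form a basis, and the matrix is well defined\<close>

lemma simple_coroot_in_cartan:
  assumes "i < n - 1"
  shows "simple_coroot n i \<in> cartan n"
proof -
  have "(\<Sum>a<n. simple_coroot n i $$ (a, a)) =
      (\<Sum>a<n. (if a = i then 1 else 0) - (if a = Suc i then 1 else 0))"
    by (rule sum.cong) (auto simp: simple_coroot_def)
  also have "\<dots> = 0"
    using assms by (simp add: sum_subtractf)
  finally show ?thesis
    by (auto simp: cartan_def simple_coroot_def diagonal_mat_def)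
qed

lemma coroot_comb_diag:
  assumes "a < n"
  shows "coroot_comb n c $$ (a, a) =
    (if a < n - 1 then c a else 0) - (if 0 < a then c (a - 1) else 0)"
proof -
  have "coroot_comb n c $$ (a, a) =
      (\<Sum>j<n - 1. (if j = a then c a else 0) - (if Suc j = a then c (a - 1) else 0))"
    using assms by (auto simp: coroot_comb_def simple_coroot_def intro!: sum.cong)
  also have "\<dots> = (if a < n - 1 then c a else 0) - (\<Sum>j<n - 1. if Suc j = a then c (a - 1) else 0)"
    by (simp add: sum_subtractf)
  also have "(\<Sum>j<n - 1. if Suc j = a then c (a - 1) else 0) = (if 0 < a then c (a - 1) else 0)"
    using assms by (cases a) auto
  finally show ?thesis .
qed

lemma coroot_comb_partial_sum:
  assumes "j < n - 1"
  shows "(\<Sum>k\<le>j. coroot_comb n c $$ (k, k)) = c j"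
  using assms by (induction j) (auto simp: coroot_comb_diag)

lemma coroot_basis:
  assumes H: "H \<in> cartan n"
  shows "H = coroot_comb n c \<longleftrightarrow> (\<forall>j<n - 1. c j = (\<Sum>k\<le>j. H $$ (k, k)))"
proof
  assume "H = coroot_comb n c"
  then show "\<forall>j<n - 1. c j = (\<Sum>k\<le>j. H $$ (k, k))"
    using coroot_comb_partial_sum by simp
next
  assume c: "\<forall>j<n - 1. c j = (\<Sum>k\<le>j. H $$ (k, k))"
  have diag: "H $$ (a, a) = coroot_comb n c $$ (a, a)" if a: "a < n" for a
  proof (cases a)
    case 0
    show ?thesis
    proof (cases "n = 1")
      case True
      then show ?thesis using H 0 by (simp add: cartan_def coroot_comb_def)
    next
      case False
      then show ?thesis using a 0 c by (simp add: coroot_comb_diag)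
    qed
  next
    case (Suc b)
    have cb: "c b = (\<Sum>k\<le>b. H $$ (k, k))" using c a Suc by simp
    have upd: "(\<Sum>k\<le>a. H $$ (k, k)) = c b + H $$ (a, a)" using cb Suc by simp
    show ?thesis
    proof (cases "a < n - 1")
      case True
      then show ?thesis using c upd a Suc by (simp add: coroot_comb_diag)
    next
      case False
      then have "{..a} = {..<n}" using a by auto
      then have "c b + H $$ (a, a) = 0" using upd H by (simp add: cartan_def)
      then show ?thesis using False a Suc by (simp add: coroot_comb_diag eq_neg_iff_add_eq_0 add.commute)
    qed
  qed
  have "H $$ (a, b) = coroot_comb n c $$ (a, b)" if "a < n" "b < n" for a b
  proof (cases "a = b")
    case False
    then show ?thesis
      using H that by (auto simp: cartan_def diagonal_mat_def coroot_comb_def simple_coroot_def)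
  qed (use diag that in simp)
  then show "H = coroot_comb n c"
    using H by (intro eq_matI) (auto simp: cartan_def coroot_comb_def)
qed

lemma weyl_act_in_cartan:
  assumes w: "w \<in> weyl_group n" and H: "H \<in> cartan n"
  shows "weyl_act n w H \<in> cartan n"
proof -
  have p: "Hilbert_Choice.inv w permutes {..<n}" using w by (simp add: weyl_group_def permutes_inv)
  have lt: "Hilbert_Choice.inv w a < n" if "a < n" for a using permutes_in_image[OF p, of a] that by simp
  have "(\<Sum>a<n. H $$ (Hilbert_Choice.inv w a, Hilbert_Choice.inv w a)) = (\<Sum>a<n. H $$ (a, a))"
    using sum.permute[OF p, of "\<lambda>a. H $$ (a, a)"] by (simp add: o_def)
  moreover have "Hilbert_Choice.inv w a \<noteq> Hilbert_Choice.inv w b" if "a \<noteq> b" for a b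
    using permutes_inj[OF p] that by (meson injD)
  ultimately show ?thesis
    using H lt by (auto simp: cartan_def weyl_act_def diagonal_mat_def)
qed

lemma
  assumes w: "w \<in> weyl_group n"
  shows refl_mat_eq: "refl_mat n w = mat (n - 1) (n - 1)
    (\<lambda>(j, i). of_bool (w i \<le> j) - of_bool (w (Suc i) \<le> j))" (is "_ = ?M")
    and refl_mat_spec: "\<And>i. i < n - 1 \<Longrightarrow>
      weyl_act n w (simple_coroot n i) = coroot_comb n (\<lambda>j. of_int (refl_mat n w $$ (j, i)))"
proof -
  have p: "w permutes {..<n}" using w by (simp add: weyl_group_def)
  have inv_eq: "Hilbert_Choice.inv w a = b \<longleftrightarrow> a = w b" for a b
    using permutes_inverses[OF p] by metis
  have ps: "(\<Sum>k\<le>j. weyl_act n w (simple_coroot n i) $$ (k, k)) =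
      of_int (of_bool (w i \<le> j) - of_bool (w (Suc i) \<le> j))"
    if "j < n - 1" "i < n - 1" for i j
  proof -
    have lt: "Hilbert_Choice.inv w a < n" if "a < n" for a
      using permutes_in_image[OF permutes_inv[OF p], of a] that by simp
    have ne: "w i \<noteq> w (Suc i)" using permutes_inj[OF p] by (metis injD n_not_Suc_n)
    have "(\<Sum>k\<le>j. weyl_act n w (simple_coroot n i) $$ (k, k)) =
        (\<Sum>k\<le>j. (if k = w i then 1 else 0) - (if k = w (Suc i) then 1 else 0))"
    proof (rule sum.cong[OF refl])
      fix k assume "k \<in> {..j}"
      then have "k < n" using that by simp
      then show "weyl_act n w (simple_coroot n i) $$ (k, k) =
          (if k = w i then 1 else 0) - (if k = w (Suc i) then 1 else 0)"
        using lt[of k] ne by (simp add: weyl_act_def simple_coroot_def inv_eq permutes_inverses[OF p])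
    qed
    then show ?thesis by (simp add: sum_subtractf)
  qed
  have iff: "weyl_act n w (simple_coroot n i) = coroot_comb n (\<lambda>j. of_int (A $$ (j, i))) \<longleftrightarrow>
      (\<forall>j<n - 1. A $$ (j, i) = of_bool (w i \<le> j) - of_bool (w (Suc i) \<le> j))"
    if i: "i < n - 1" for A :: "int mat" and i
  proof -
    have "weyl_act n w (simple_coroot n i) \<in> cartan n"
      by (intro weyl_act_in_cartan simple_coroot_in_cartan w i)
    from coroot_basis[OF this] show ?thesis
      using ps i by (simp only: of_int_eq_iff cong: imp_cong)
  qed
  let ?P = "\<lambda>A :: int mat. A \<in> carrier_mat (n - 1) (n - 1) \<and>
    (\<forall>i<n - 1. weyl_act n w (simple_coroot n i) = coroot_comb n (\<lambda>j. of_int (A $$ (j, i))))"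
  have M: "?P ?M"
    using iff by (auto simp del: of_int_diff)
  moreover have "A = ?M" if "?P A" for A
    using that iff by (intro eq_matI) auto
  ultimately show eq: "refl_mat n w = ?M"
    unfolding refl_mat_def by (rule the_equality)
  show "weyl_act n w (simple_coroot n i) = coroot_comb n (\<lambda>j. of_int (refl_mat n w $$ (j, i)))"
    if "i < n - 1" for i
    using M that unfolding eq by blast
qed

lemma refl_det_const_coeff:
  assumes w: "w \<in> weyl_group n" and z: "coeff2 z 0 0 = 0"
  shows "coeff2 (refl_det n z w) 0 0 = 1"
proof -
  let ?h = "\<lambda>F :: int fps2. coeff2 F 0 0"
  let ?A = "1\<^sub>m (n - 1) - z \<cdot>\<^sub>m map_mat const2 (refl_mat n w)"
  interpret h: comm_ring_hom ?h
    by unfold_locales (simp_all add: coeff2_def fps_mult_nth)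
  have "?h (det ?A) = det (map_mat ?h ?A)"
    by (simp add: h.hom_det)
  also have "map_mat ?h ?A = 1\<^sub>m (n - 1)"
    by (rule eq_matI) (auto simp: refl_mat_eq[OF w] h.hom_minus h.hom_mult z)
  finally show ?thesis by (simp add: refl_det_def)
qed

subsection \<open>The integrand lies in \<open>\<int>[Q][[q,t]]\<close>\<close>

lemma fps_coeffs_subring:
  fixes S :: "'a::comm_ring_1 set"
  assumes one: "1 \<in> S" and closed: "\<forall>a\<in>S. \<forall>b\<in>S. a - b \<in> S \<and> a * b \<in> S"
  defines "T \<equiv> {F. \<forall>k. fps_nth F k \<in> S}"
  shows "1 \<in> T"
    and "\<And>F G. F \<in> T \<Longrightarrow> G \<in> T \<Longrightarrow> F - G \<in> T"
    and "\<And>F G. F \<in> T \<Longrightarrow> G \<in> T \<Longrightarrow> F * G \<in> T"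
    and "\<And>F y. F \<in> T \<Longrightarrow> y \<in> S \<Longrightarrow> fps_right_inverse F y \<in> T"
    and "fps_X \<in> T"
    and "\<And>a. a \<in> S \<Longrightarrow> fps_const a \<in> T"
proof -
  have diff: "a - b \<in> S" and mult: "a * b \<in> S" if "a \<in> S" "b \<in> S" for a b
    using closed that by auto
  have zero: "0 \<in> S" using diff[OF one one] by simp
  have neg: "- a \<in> S" if "a \<in> S" for a using diff[OF zero that] by simp
  have add: "a + b \<in> S" if "a \<in> S" "b \<in> S" for a b using diff[OF that(1) neg[OF that(2)]] by simp
  have sum: "sum f A \<in> S" if "\<And>x. x \<in> A \<Longrightarrow> f x \<in> S" for f :: "nat \<Rightarrow> 'a" and A
    using that by (induction A rule: infinite_finite_induct) (auto intro: zero add)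
  show "1 \<in> T" "fps_X \<in> T" using one zero by (auto simp: T_def fps_one_nth fps_X_nth)
  show "fps_const a \<in> T" if "a \<in> S" for a using that zero by (simp add: T_def)
  show "F - G \<in> T" if "F \<in> T" "G \<in> T" for F G using that diff by (simp add: T_def)
  show "F * G \<in> T" if "F \<in> T" "G \<in> T" for F G
    using that by (auto simp: T_def fps_mult_nth intro!: sum mult)
  show "fps_right_inverse F y \<in> T" if "F \<in> T" "y \<in> S" for F y
  proof -
    have "fps_right_inverse_constructor F y k \<in> S" for k
    proof (induction k rule: less_induct)
      case (less k)
      show ?case
      proof (cases k)
        case (Suc m)
        have "(\<Sum>i = 1..k. fps_nth F i * fps_right_inverse_constructor F y (k - i)) \<in> S"
          using that less Suc by (intro sum mult) (auto simp: T_def)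
        then show ?thesis using that(2) Suc by (auto intro!: neg mult)
      qed (use that in simp)
    qed
    then show ?thesis by (simp add: T_def)
  qed
qed

lemma root_lattice_add:
  assumes "\<alpha> \<in> root_lattice n" "\<beta> \<in> root_lattice n"
  shows "\<alpha> + \<beta> \<in> root_lattice n"
  using root_lattice_diff[OF assms(1) root_lattice_diff[OF root_lattice_zero assms(2)]] by simp

lemma root_group_ring_subring:
  "1 \<in> root_group_ring n"
  "f \<in> root_group_ring n \<Longrightarrow> g \<in> root_group_ring n \<Longrightarrow> f - g \<in> root_group_ring n"
  "f \<in> root_group_ring n \<Longrightarrow> g \<in> root_group_ring n \<Longrightarrow> f * g \<in> root_group_ring n"
proof -
  show "1 \<in> root_group_ring n"
    by (simp add: root_group_ring_def root_lattice_zero)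
  show "f - g \<in> root_group_ring n" if "f \<in> root_group_ring n" "g \<in> root_group_ring n"
    using that keys_diff[of f g] by (auto simp: root_group_ring_def)
  show "f * g \<in> root_group_ring n" if "f \<in> root_group_ring n" "g \<in> root_group_ring n"
    using that keys_mult[of f g] by (force simp: root_group_ring_def intro: root_lattice_add)
qed

lemma integrand_in_root_group_ring:
  "coeff2 (\<Prod>\<alpha>\<in>root_system n.
      quot2 ((1 - qvar * tvar * e_exp \<alpha>) * (1 - e_exp \<alpha>))
            ((1 - qvar * e_exp \<alpha>) * (1 - tvar * e_exp \<alpha>))) i j \<in> root_group_ring n"
proof -
  define S where "S = root_group_ring n"
  define T where "T = {F. \<forall>k. fps_nth F k \<in> S}"
  define U where "U = {F. \<forall>k. fps_nth F k \<in> T}"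
  have S: "1 \<in> S" "\<forall>a\<in>S. \<forall>b\<in>S. a - b \<in> S \<and> a * b \<in> S"
    unfolding S_def by (simp_all add: root_group_ring_subring)
  note T = fps_coeffs_subring[OF S, folded T_def]
  have T': "\<forall>a\<in>T. \<forall>b\<in>T. a - b \<in> T \<and> a * b \<in> T"
    using T(2,3) by blast
  note U = fps_coeffs_subring[OF T(1) T', folded U_def]
  have e: "e_exp \<alpha> \<in> U" if "\<alpha> \<in> root_system n" for \<alpha>
  proof -
    have "Poly_Mapping.single \<alpha> 1 \<in> S"
      unfolding S_def root_group_ring_def using root_lattice_root[OF that] by simp
    then show ?thesis
      unfolding e_exp_def const2_def by (intro U(6) T(6))
  qed
  have q: "qvar \<in> U" and t: "tvar \<in> U"
    unfolding qvar_def tvar_def by (intro U(5,6) T(5))+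
  have quot: "quot2 A B \<in> U" if "A \<in> U" "B \<in> U" for A B
    unfolding quot2_def
  proof (intro U(3,4) that T(4) S(1))
    show "fps_nth B 0 \<in> T" using that(2) by (simp add: U_def)
  qed
  have prod: "prod f A \<in> U" if "\<And>x. x \<in> A \<Longrightarrow> f x \<in> U" for f :: "weight \<Rightarrow> _" and A
    using that by (induction A rule: infinite_finite_induct) (auto intro: U(1,3))
  have "(\<Prod>\<alpha>\<in>root_system n.
      quot2 ((1 - qvar * tvar * e_exp \<alpha>) * (1 - e_exp \<alpha>))
            ((1 - qvar * e_exp \<alpha>) * (1 - tvar * e_exp \<alpha>))) \<in> U"
    by (intro prod quot U(1-3) q t e)
  then show ?thesis
    by (simp add: coeff2_def U_def T_def S_def)
qed

end

theory Submission
  imports Defs "HOL-Computational_Algebra.Polynomial_Factorial"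
begin

text \<open>
  Write \<open>\<omega>(x) = (1 - qtx)(1 - x) / ((1 - qx)(1 - tx))\<close> and let \<open>\<Delta>(N)\<close> be the product of
  \<open>\<omega>(x\<^sub>i/x\<^sub>j)\<close> over distinct \<open>i, j \<in> N\<close>; its specialisation at \<open>q = 0\<close> is the
  Hall-Littlewood weight \<open>HL(N)\<close>.  A determinantal identity for Macdonald's difference operators
  yields a linear relation between products over the subsets \<open>B\<close> of \<open>N\<close>. Multiplied by
  \<open>\<Delta>(N)\<close>, its term at \<open>B\<close> becomes \<open>HL(B) \<Delta>(N - B)\<close> times a product of factors
  \<open>\<omega>(x\<^sub>j/x\<^sub>i)\<close>, \<open>i \<in> B\<close>, \<open>j \<in> N - B\<close>, and by degree reasons the last product
  does not contribute to the constant term.  The relation thus becomes a recursion for the constant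
  terms of \<open>HL\<close> and \<open>\<Delta>\<close>, solved by \<open>n! h\<^sub>n\<close> up to powers of \<open>1 - q\<close>,
  \<open>1 - t\<close> and \<open>1 - qt\<close>, where the generating series of \<open>h\<^sub>n\<close> is a product of two
  \<open>q\<close>-exponentials.  On the other side, a permutation contributes the product over its cycle
  lengths \<open>k\<close> of \<open>(1 - q\<^sup>k t\<^sup>k) / ((1 - q\<^sup>k)(1 - t\<^sup>k))\<close>, and Newton's identities show
  that the sum over the symmetric group is \<open>n! h\<^sub>n\<close> as well.
\<close>

section \<open>A determinantal identity\<close>

definition pair_prod :: "nat \<Rightarrow> (nat \<Rightarrow> nat \<Rightarrow> 'a::comm_monoid_mult) \<Rightarrow> 'a" where
  "pair_prod n f = (\<Prod>j<n. \<Prod>i<j. f i j)"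

text \<open>Induction on \<open>n\<close> through the dependence on the last node: as a polynomial
  in it, the determinant has the smaller Vandermonde product as its coefficient of degree
  \<open>n\<close> and vanishes at the other \<open>n\<close> nodes. If two of these coincide, both
  sides are 0.\<close>

lemma det_vandermonde:
  fixes x :: "nat \<Rightarrow> 'a::field"
  shows "det (mat n n (\<lambda>(i, j). x i ^ j)) = pair_prod n (\<lambda>i j. x j - x i)"
proof (induction n)
  case 0
  then show ?case by (simp add: pair_prod_def)
next
  case (Suc n)
  let ?V = "\<lambda>x. mat (Suc n) (Suc n) (\<lambda>(i, j). x i ^ j) :: 'a mat"
  show ?case
  proof (cases "inj_on x {..<n}")
    case False
    then obtain i k where ik: "i < n" "k < n" "i \<noteq> k" "x i = x k"
      by (auto simp: inj_on_def)
    have "det (?V x) = 0"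
      by (rule det_identical_rows[of _ "Suc n" i k]) (use ik in \<open>auto intro!: eq_vecI\<close>)
    moreover have "\<exists>j<Suc n. \<exists>i<j. x j - x i = 0"
      using ik by (metis less_SucI linorder_neq_iff right_minus_eq)
    then have "pair_prod (Suc n) (\<lambda>i j. x j - x i) = 0"
      unfolding pair_prod_def by (simp only: prod_zero_iff finite_lessThan) (auto simp: Bex_def)
    ultimately show ?thesis by simp
  next
    case True
    \<comment> \<open>The cofactors of row \<open>n\<close> do not involve \<open>x n\<close>, so
      \<open>p\<close> is the determinant with its last node replaced by an indeterminate.\<close>
    define c where "c j = cofactor (?V x) n j" for j
    define p where "p = (\<Sum>j<Suc n. monom (c j) j)"
    have poly_p: "poly p y = det (?V (x(n := y)))" for y
    proof -
      have "det (?V (x(n := y))) = (\<Sum>j<Suc n. y ^ j * cofactor (?V (x(n := y))) n j)"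
        by (subst laplace_expansion_row[of _ "Suc n" n]) auto
      also have "\<dots> = (\<Sum>j<Suc n. c j * y ^ j)"
      proof (rule sum.cong[OF refl])
        fix j assume j: "j \<in> {..<Suc n}"
        have "mat_delete (?V (x(n := y))) n j = mat_delete (?V x) n j"
          using j by (intro eq_matI) (auto simp: mat_delete_def)
        then show "y ^ j * cofactor (?V (x(n := y))) n j = c j * y ^ j"
          by (simp add: c_def cofactor_def)
      qed
      finally show ?thesis by (simp add: p_def poly_sum poly_monom)
    qed
    have cn: "c n = pair_prod n (\<lambda>i j. x j - x i)"
    proof -
      have "mat_delete (?V x) n n = mat n n (\<lambda>(i, j). x i ^ j)"
        by (intro eq_matI) (auto simp: mat_delete_def)
      then show ?thesis by (simp add: c_def cofactor_def Suc.IH)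
    qed
    \<comment> \<open>The deviation from the expected factorisation: its coefficients from degree
      \<open>n\<close> on cancel, yet it has \<open>n\<close> distinct roots.\<close>
    define r where "r = p - smult (c n) (\<Prod>i<n. [:- x i, 1:])"
    have deg: "degree (\<Prod>i<n. [:- x i, 1:]) = n" and lead: "lead_coeff (\<Prod>i<n. [:- x i, 1:]) = 1"
      by (subst degree_prod_eq_sum_degree; simp) (simp add: lead_coeff_prod)
    have coeffp: "coeff p j = (if j \<le> n then c j else 0)" for j
      by (auto simp: p_def coeff_sum)
    have coeffr: "coeff r j = 0" if "j \<ge> n" for j
    proof (cases "j = n")
      case True
      then show ?thesis using deg lead by (simp add: r_def coeffp)
    next
      case False
      then have "coeff (\<Prod>i<n. [:- x i, 1:]) j = 0" using deg that by (intro coeff_eq_0) simp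
      then show ?thesis using False that by (simp add: r_def coeffp)
    qed
    have "r = 0"
    proof (rule ccontr)
      assume nz: "r \<noteq> 0"
      have dr: "degree r < n"
        using coeffr[of "degree r"] nz by (metis leading_coeff_neq_0 linorder_not_less)
      have "poly r (x i) = 0" if "i < n" for i
      proof -
        have "det (?V (x(n := x i))) = 0"
          by (rule det_identical_rows[of _ "Suc n" i n]) (use that in \<open>auto intro!: eq_vecI\<close>)
        moreover have "(\<Prod>k<n. x i - x k) = 0" using that by (intro prod_zero) auto
        ultimately show ?thesis by (simp add: r_def poly_p poly_prod)
      qed
      then have "x ` {..<n} \<subseteq> {a. poly r a = 0}" by auto
      then have "card (x ` {..<n}) \<le> card {a. poly r a = 0}"
        by (intro card_mono poly_roots_finite nz)
      then have "n \<le> card {a. poly r a = 0}"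
        by (simp add: card_image[OF True])
      then show False using card_poly_roots_bound[OF nz] dr by simp
    qed
    then have "poly p (x n) = c n * (\<Prod>i<n. x n - x i)"
      by (simp add: r_def poly_prod)
    then show ?thesis by (simp add: poly_p cn pair_prod_def)
  qed
qed

lemma pair_prod_mult: "pair_prod n (\<lambda>i j. f i j * g i j) = pair_prod n f * pair_prod n g"
  by (simp add: pair_prod_def prod.distrib)

text \<open>The binomial coefficient counts the pairs inside \<open>B\<close>; symmetry of
  \<open>f\<close> allows every mixed pair to be written with its member of \<open>B\<close> first,
  whichever of the two is smaller.\<close>

lemma pair_prod_split:
  fixes t :: "'a::comm_monoid_mult"
  assumes sym: "\<And>i j. f i j = f j i"
    and "\<And>i j. i \<in> B \<Longrightarrow> j \<in> B \<Longrightarrow> f i j = t"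
    and "\<And>i j. i \<notin> B \<Longrightarrow> j \<notin> B \<Longrightarrow> f i j = 1"
  shows "pair_prod n f =
    t ^ (card (B \<inter> {..<n}) choose 2) * (\<Prod>i\<in>B \<inter> {..<n}. \<Prod>j\<in>{..<n} - B. f i j)"
proof (induction n)
  case 0
  then show ?case by (simp add: pair_prod_def numeral_2_eq_2)
next
  case (Suc n)
  have step: "pair_prod (Suc n) f = pair_prod n f * (\<Prod>i<n. f i n)"
    by (simp add: pair_prod_def)
  have split: "(\<Prod>i<n. f i n) = (\<Prod>i\<in>B \<inter> {..<n}. f i n) * (\<Prod>i\<in>{..<n} - B. f i n)"
    by (subst prod.union_disjoint[symmetric]) (auto intro!: prod.cong)
  show ?case
  proof (cases "n \<in> B")
    case True
    have e1: "B \<inter> {..<Suc n} = insert n (B \<inter> {..<n})" and e2: "{..<Suc n} - B = {..<n} - B"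
      using True by (auto simp: less_Suc_eq)
    have "(\<Prod>i\<in>B \<inter> {..<n}. f i n) = t ^ card (B \<inter> {..<n})"
      using True assms(2) by (simp add: prod.cong)
    moreover have "(\<Prod>i\<in>{..<n} - B. f i n) = (\<Prod>j\<in>{..<n} - B. f n j)"
      using sym by (intro prod.cong) auto
    moreover have "Suc k choose 2 = (k choose 2) + k" for k
      by (simp add: numeral_2_eq_2)
    ultimately show ?thesis
      unfolding step split Suc.IH e1 e2 by (simp add: power_add ac_simps)
  next
    case False
    have e1: "B \<inter> {..<Suc n} = B \<inter> {..<n}" and e2: "{..<Suc n} - B = insert n ({..<n} - B)"
      using False by (auto simp: less_Suc_eq)
    have "(\<Prod>i\<in>{..<n} - B. f i n) = 1"
      using False assms(3) by (intro prod.neutral) auto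
    then show ?thesis
      unfolding step split Suc.IH e1 e2 by (simp add: prod.distrib ac_simps)
  qed
qed

section \<open>Subset sums of Macdonald type as determinants\<close>

lemma permutes_lt: "p permutes {0..<n} \<Longrightarrow> i < n \<Longrightarrow> p i < n" for i n :: nat
  using permutes_in_image[of p "{0..<n}" i] by simp

text \<open>The generating polynomial in \<open>u\<close> of Macdonald's difference operators \<open>D\<^sub>r\<close>, with the
  product of the shifts of the variables in \<open>B\<close> replaced by the scalars \<open>\<rho>\<close>.\<close>

definition hsum :: "'i set \<Rightarrow> ('i \<Rightarrow> 'a) \<Rightarrow> 'a \<Rightarrow> ('i \<Rightarrow> 'a) \<Rightarrow> 'a \<Rightarrow> 'a::field" where
  "hsum N x t \<rho> u = (\<Sum>B\<in>Pow N. (- u) ^ card B * t ^ (card B choose 2) * (\<Prod>i\<in>B. \<rho> i) *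
     (\<Prod>i\<in>B. \<Prod>j\<in>N - B. (x j - t * x i) / (x j - x i)))"

text \<open>Expanding the product in each term of the Leibniz formula chooses the set
  \<open>B\<close> of rows in which \<open>x i\<close> becomes \<open>t * x i\<close>. What remains
  for each \<open>B\<close> is a Vandermonde determinant at the shifted nodes; its quotient by the
  one in \<open>x\<close> gives \<open>t\<close> for a pair in \<open>B\<close>, 1 for a pair
  outside, and the fraction of \<open>hsum\<close> for a mixed pair.\<close>

lemma det_hsum:
  fixes x :: "nat \<Rightarrow> 'a::field"
  assumes inj: "inj_on x {..<n}"
  shows "det (mat n n (\<lambda>(i, j). x i ^ j - u * \<rho> i * (t * x i) ^ j)) =
    hsum {..<n} x t \<rho> u * pair_prod n (\<lambda>i j. x j - x i)"
proof -
  let ?y = "\<lambda>B i. if i \<in> B then t * x i else x i"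
  have V: "(\<Sum>p\<in>{p. p permutes {0..<n}}. signof p * (\<Prod>i = 0..<n. z i ^ p i)) =
      pair_prod n (\<lambda>i j. z j - z i)" for z :: "nat \<Rightarrow> 'a"
  proof -
    have "det (mat n n (\<lambda>(i, j). z i ^ j)) =
        (\<Sum>p\<in>{p. p permutes {0..<n}}. signof p * (\<Prod>i = 0..<n. z i ^ p i))"
      by (subst det_def') (auto intro!: sum.cong prod.cong simp: permutes_lt)
    then show ?thesis by (simp add: det_vandermonde)
  qed
  have "det (mat n n (\<lambda>(i, j). x i ^ j - u * \<rho> i * (t * x i) ^ j)) =
      (\<Sum>p\<in>{p. p permutes {0..<n}}. signof p *
        (\<Prod>i = 0..<n. - (u * \<rho> i) * (t * x i) ^ p i + x i ^ p i))"
    by (subst det_def') (auto intro!: sum.cong prod.cong simp: permutes_lt)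
  also have "\<dots> = (\<Sum>p\<in>{p. p permutes {0..<n}}. signof p *
        (\<Sum>B\<in>Pow {0..<n}. (\<Prod>i\<in>B. - (u * \<rho> i)) * (\<Prod>i = 0..<n. ?y B i ^ p i)))"
  proof (rule sum.cong[OF refl], rule arg_cong[where f = "(*) _"])
    fix p
    have "(\<Prod>i = 0..<n. - (u * \<rho> i) * (t * x i) ^ p i + x i ^ p i) =
       (\<Sum>B\<in>Pow {0..<n}. (\<Prod>i\<in>B. - (u * \<rho> i) * (t * x i) ^ p i) * (\<Prod>i\<in>{0..<n} - B. x i ^ p i))"
      by (rule prod_add) simp
    also have "\<dots> = (\<Sum>B\<in>Pow {0..<n}. (\<Prod>i\<in>B. - (u * \<rho> i)) * (\<Prod>i = 0..<n. ?y B i ^ p i))"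
    proof (rule sum.cong[OF refl])
      fix B assume B: "B \<in> Pow {0..<n}"
      have "(\<Prod>i = 0..<n. ?y B i ^ p i) = (\<Prod>i\<in>{0..<n} - B. ?y B i ^ p i) * (\<Prod>i\<in>B. ?y B i ^ p i)"
        using B by (intro prod.subset_diff) auto
      then show "(\<Prod>i\<in>B. - (u * \<rho> i) * (t * x i) ^ p i) * (\<Prod>i\<in>{0..<n} - B. x i ^ p i) =
          (\<Prod>i\<in>B. - (u * \<rho> i)) * (\<Prod>i = 0..<n. ?y B i ^ p i)"
        by (simp add: prod.distrib del: mult_minus_left)
    qed
    finally show "(\<Prod>i = 0..<n. - (u * \<rho> i) * (t * x i) ^ p i + x i ^ p i) =
       (\<Sum>B\<in>Pow {0..<n}. (\<Prod>i\<in>B. - (u * \<rho> i)) * (\<Prod>i = 0..<n. ?y B i ^ p i))" .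
  qed
  also have "\<dots> = (\<Sum>B\<in>Pow {0..<n}. \<Sum>p\<in>{p. p permutes {0..<n}}. signof p *
        ((\<Prod>i\<in>B. - (u * \<rho> i)) * (\<Prod>i = 0..<n. ?y B i ^ p i)))"
    unfolding sum_distrib_left by (rule sum.swap)
  also have "\<dots> = (\<Sum>B\<in>Pow {0..<n}. (\<Prod>i\<in>B. - (u * \<rho> i)) *
      (\<Sum>p\<in>{p. p permutes {0..<n}}. signof p * (\<Prod>i = 0..<n. ?y B i ^ p i)))"
    by (simp only: sum_distrib_left mult.left_commute)
  also have "\<dots> = (\<Sum>B\<in>Pow {..<n}. (\<Prod>i\<in>B. - (u * \<rho> i)) * pair_prod n (\<lambda>i j. ?y B j - ?y B i))"
    unfolding V unfolding atLeast0LessThan by (rule refl)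
  also have "\<dots> = hsum {..<n} x t \<rho> u * pair_prod n (\<lambda>i j. x j - x i)"
    unfolding hsum_def sum_distrib_right
  proof (rule sum.cong[OF refl])
    fix B assume B: "B \<in> Pow {..<n}"
    have u: "(\<Prod>i\<in>B. - (u * \<rho> i)) = (- u) ^ card B * prod \<rho> B"
      by (simp only: mult_minus_left[symmetric] prod.distrib prod_constant)
    \<comment> \<open>The quotient of the shifted by the original difference. The values
      \<open>t\<close> and 1 are also imposed for \<open>i = j\<close>, since
      \<open>pair_prod_split\<close> asks for them at all indices.\<close>
    let ?f = "\<lambda>i j. if i \<in> B \<and> j \<in> B then t else if i \<notin> B \<and> j \<notin> B then 1
      else (?y B j - ?y B i) / (x j - x i)"
    have "pair_prod n (\<lambda>i j. ?y B j - ?y B i) = pair_prod n (\<lambda>i j. ?f i j * (x j - x i))"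
      unfolding pair_prod_def
    proof (intro prod.cong refl)
      fix i j assume "j \<in> {..<n}" "i \<in> {..<j}"
      then have "x j - x i \<noteq> 0" using inj_onD[OF inj, of i j] by auto
      then show "?y B j - ?y B i = ?f i j * (x j - x i)"
        by (cases "i \<in> B \<and> j \<in> B") (auto simp: right_diff_distrib[of t])
    qed
    also have "\<dots> = pair_prod n ?f * pair_prod n (\<lambda>i j. x j - x i)"
      by (rule pair_prod_mult)
    also have "pair_prod n ?f =
        t ^ (card (B \<inter> {..<n}) choose 2) * (\<Prod>i\<in>B \<inter> {..<n}. \<Prod>j\<in>{..<n} - B. ?f i j)"
    proof (rule pair_prod_split)
      show "?f i j = ?f j i" for i j
        using minus_divide_divide[of "?y B j - ?y B i" "x j - x i"] by auto
    next
      fix i j assume "i \<in> B" "j \<in> B" then show "?f i j = t" by simp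
    next
      fix i j assume "i \<notin> B" "j \<notin> B" then show "?f i j = 1" by simp
    qed
    also have "B \<inter> {..<n} = B" using B by auto
    also have "(\<Prod>i\<in>B. \<Prod>j\<in>{..<n} - B. ?f i j) = (\<Prod>i\<in>B. \<Prod>j\<in>{..<n} - B. (x j - t * x i) / (x j - x i))"
      by (intro prod.cong) auto
    finally show "(\<Prod>i\<in>B. - (u * \<rho> i)) * pair_prod n (\<lambda>i j. ?y B j - ?y B i) =
      (- u) ^ card B * t ^ (card B choose 2) * (\<Prod>i\<in>B. \<rho> i) *
        (\<Prod>i\<in>B. \<Prod>j\<in>{..<n} - B. (x j - t * x i) / (x j - x i)) * pair_prod n (\<lambda>i j. x j - x i)"
      by (simp add: u)
  qed
  finally show ?thesis .
qed

section \<open>The duality between \<open>u = 1\<close> and \<open>u = t\<close>\<close>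

lemma det_diagonal:
  "det (mat n n (\<lambda>(i, j). if i = j then f i else 0)) = (\<Prod>i<n. f i)"
proof -
  let ?A = "mat n n (\<lambda>(i, j). if i = j then f i else 0)"
  have "det ?A = prod_list (diag_mat ?A)"
    by (rule det_upper_triangular) auto
  also have "\<dots> = (\<Prod>i = 0..<n. f i)"
    by (simp add: prod_list_diag_prod)
  finally show ?thesis by (simp add: atLeast0LessThan)
qed

text \<open>In row 0 only the last entry \<open>- v 0\<close> can be nonzero, and its minor is the
  identity. Such a matrix shifts columns by one and applies a linear relation to obtain the
  last.\<close>

lemma companion_det:
  fixes v :: "nat \<Rightarrow> 'a::comm_ring_1"
  assumes "n > 0"
  shows "det (mat n n (\<lambda>(i, j). if Suc j < n then of_bool (i = Suc j) else - v i)) = (- 1) ^ n * v 0"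
proof -
  let ?A = "mat n n (\<lambda>(i, j). if Suc j < n then of_bool (i = Suc j) else - v i)"
  obtain m where n: "n = Suc m" using assms by (cases n) auto
  have "det ?A = (\<Sum>j<n. ?A $$ (0, j) * cofactor ?A 0 j)"
    by (rule laplace_expansion_row) (use assms in auto)
  also have "\<dots> = (\<Sum>j<n. if j = m then - v 0 * cofactor ?A 0 m else 0)"
    by (rule sum.cong) (auto simp: n)
  also have "\<dots> = - v 0 * cofactor ?A 0 m"
    by (simp add: n)
  also have "mat_delete ?A 0 m = 1\<^sub>m m"
    by (intro eq_matI) (auto simp: mat_delete_def n)
  then have "cofactor ?A 0 m = (- 1) ^ m"
    by (simp add: cofactor_def)
  finally show ?thesis by (simp add: n)
qed

text \<open>Both sides are determinants of \<open>n\<close> consecutive columns among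
  \<open>c\<^sub>j = x\<^sup>j - \<rho> (t x)\<^sup>j\<close>, \<open>0 \<le> j \<le> n\<close>.  As \<open>\<rho> = Y(x) / Y(t x)\<close>, the coefficients of
  \<open>Y\<close> give a linear relation between these columns.\<close>

lemma hsum_duality:
  fixes x :: "nat \<Rightarrow> 'a::field"
  assumes inj: "inj_on x {..<n}" and nz: "\<And>i. i < n \<Longrightarrow> x i \<noteq> 0"
    and den: "\<And>i k. i < n \<Longrightarrow> k < n \<Longrightarrow> x k - a * t * x i \<noteq> 0" and "n > 0"
  defines "\<rho> \<equiv> \<lambda>i. \<Prod>k<n. (x k - a * x i) / (x k - a * t * x i)"
  shows "hsum {..<n} x t \<rho> 1 = a ^ n * hsum {..<n} x t \<rho> t"
proof -
  define Y where "Y = (\<Prod>k<n. [:x k, - a:])"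
  define c where "c i j = x i ^ j - \<rho> i * (t * x i) ^ j" for i j
  let ?V = "pair_prod n (\<lambda>i j. x j - x i)"
  have V: "?V \<noteq> 0"
    unfolding pair_prod_def using inj_onD[OF inj] by (force simp: prod_zero_iff)
  have Y: "degree (\<Prod>k<m. [:x k, - a:]) \<le> m \<and> coeff (\<Prod>k<m. [:x k, - a:]) m = (- a) ^ m" for m
  proof (induction m)
    case (Suc m)
    then have *: "degree (\<Prod>k<m. [:x k, - a:]) \<le> m" by simp
    let ?P = "\<Prod>k<m. [:x k, - a:]"
    have "degree (?P * [:x m, - a:]) \<le> degree ?P + degree [:x m, - a:]"
      by (rule degree_mult_le)
    also have "\<dots> \<le> m + 1" by (rule add_mono[OF *]) simp
    also have "\<dots> = Suc m" by simp
    finally have 1: "degree (?P * [:x m, - a:]) \<le> Suc m" .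
    have "coeff ?P (Suc m) = 0" by (rule coeff_eq_0) (rule le_imp_less_Suc[OF *])
    moreover have "?P * [:x m, - a:] = smult (x m) ?P + pCons 0 (smult (- a) ?P)"
      by (subst mult.commute) (simp only: mult_pCons_left mult_zero_left pCons_0_0 add_0_right)
    ultimately have "coeff (?P * [:x m, - a:]) (Suc m) = - a * coeff ?P m"
      by (simp only: coeff_add coeff_smult coeff_pCons_Suc mult_zero_right add_0_left)
    then have 2: "coeff (?P * [:x m, - a:]) (Suc m) = (- a) ^ Suc m"
      using Suc by (simp only: power_Suc)
    show ?case using 1 2 by (simp only: prod.lessThan_Suc)
  qed simp
  then have degY: "degree Y \<le> n" and Yn: "coeff Y n = (- a) ^ n"
    by (simp_all add: Y_def)
  have Y0: "coeff Y 0 = (\<Prod>k<n. x k)"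
    unfolding poly_0_coeff_0[symmetric] by (simp add: Y_def poly_prod)
  \<comment> \<open>The sum is \<open>Y(x i) - \<rho> i * Y(t * x i)\<close>, which vanishes by the
    choice of \<open>\<rho>\<close>.\<close>
  have rel: "(\<Sum>j<Suc n. coeff Y j * c i j) = 0" if "i < n" for i
  proof -
    have Yt: "poly Y (t * x i) = (\<Prod>k<n. x k - a * t * x i)"
      by (simp add: Y_def poly_prod algebra_simps)
    have "(\<Prod>k<n. x k - a * t * x i) \<noteq> 0" using den that by auto
    then have "\<rho> i * poly Y (t * x i) = poly Y (x i)"
      unfolding Yt by (simp add: \<rho>_def prod_dividef) (simp add: Y_def poly_prod algebra_simps)
    moreover have pY: "poly Y z = (\<Sum>j<Suc n. coeff Y j * z ^ j)" for z
      by (subst poly_as_sum_of_monoms'[OF degY, symmetric])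
        (simp only: poly_sum poly_monom lessThan_Suc_atMost)
    have "(\<Sum>j<Suc n. coeff Y j * c i j) = poly Y (x i) - \<rho> i * poly Y (t * x i)"
      unfolding pY sum_distrib_left sum_subtractf[symmetric]
      by (rule sum.cong) (simp_all add: c_def algebra_simps)
    ultimately show ?thesis by simp
  qed
  let ?C0 = "mat n n (\<lambda>(i, j). c i j)" and ?C1 = "mat n n (\<lambda>(i, j). c i (Suc j))"
  let ?K = "mat n n (\<lambda>(i, j). if Suc j < n then of_bool (i = Suc j) else - coeff Y i)"
  let ?D = "mat n n (\<lambda>(i, j). if i = j then (if Suc i < n then 1 else coeff Y n) else 0)"
  \<comment> \<open>The first \<open>n - 1\<close> columns of \<open>?K\<close> shift those of
    \<open>?C0\<close> by one, and its last column applies \<open>rel\<close>. The factor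
    \<open>coeff Y n = (- a) ^ n\<close> is kept in \<open>?D\<close> and not divided out, so that
    \<open>a = 0\<close> remains allowed.\<close>
  have CK: "?C0 * ?K = ?C1 * ?D"
  proof (intro eq_matI)
    fix i j assume "i < dim_row (?C1 * ?D)" "j < dim_col (?C1 * ?D)"
    then have ij: "i < n" "j < n" by auto
    have l: "(?C0 * ?K) $$ (i, j) = (\<Sum>k<n. c i k * (if Suc j < n then of_bool (k = Suc j) else - coeff Y k))"
      using ij by (simp add: scalar_prod_def atLeast0LessThan)
    have r: "(?C1 * ?D) $$ (i, j) = c i (Suc j) * (if Suc j < n then 1 else coeff Y n)"
    proof -
      have "(?C1 * ?D) $$ (i, j) = (\<Sum>k = 0..<n. ?C1 $$ (i, k) * ?D $$ (k, j))"
        using ij by (simp add: scalar_prod_def)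
      also have "\<dots> = (\<Sum>k = 0..<n. if k = j then c i (Suc j) * (if Suc j < n then 1 else coeff Y n) else 0)"
        using ij by (intro sum.cong) auto
      finally show ?thesis using ij by simp
    qed
    show "(?C0 * ?K) $$ (i, j) = (?C1 * ?D) $$ (i, j)"
    proof (cases "Suc j < n")
      case True
      then show ?thesis unfolding l r by simp
    next
      case False
      then have j: "Suc j = n" using ij by simp
      have "(\<Sum>k<n. coeff Y k * c i k) = - (coeff Y n * c i n)"
        using rel[OF ij(1)] by (simp add: eq_neg_iff_add_eq_0)
      moreover have "(\<Sum>k<n. c i k * - coeff Y k) = - (\<Sum>k<n. coeff Y k * c i k)"
        unfolding sum_negf[symmetric] by (rule sum.cong) simp_all
      ultimately have "(\<Sum>k<n. c i k * - coeff Y k) = c i n * coeff Y n"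
        by (simp only: minus_minus mult.commute[of "coeff Y n"])
      then show ?thesis unfolding l r j by (simp only: less_irrefl if_False)
    qed
  qed auto
  have "det (?C0 * ?K) = det ?C0 * det ?K" "det (?C1 * ?D) = det ?C1 * det ?D"
    by (rule det_mult[of _ n]; simp)+
  then have "det ?C0 * det ?K = det ?C1 * det ?D"
    by (simp only: CK)
  moreover have "det ?D = coeff Y n"
  proof -
    have "det ?D = (\<Prod>j<n. if Suc j < n then 1 else coeff Y n)"
      by (rule det_diagonal[of n "\<lambda>j. if Suc j < n then 1 else coeff Y n"])
    also have "\<dots> = (\<Prod>j<n. if j = n - 1 then coeff Y n else 1)"
      by (intro prod.cong) auto
    finally show ?thesis using \<open>n > 0\<close> by simp
  qed
  moreover have "det ?K = (- 1) ^ n * coeff Y 0"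
    using \<open>n > 0\<close> by (rule companion_det)
  moreover have "det ?C0 = hsum {..<n} x t \<rho> 1 * ?V"
    using det_hsum[OF inj, of 1 \<rho> t] by (simp add: c_def)
  \<comment> \<open>Row \<open>i\<close> of \<open>?C1\<close> has the common factor
    \<open>x i\<close>; what is left is the matrix of \<open>det_hsum\<close> at
    \<open>u = t\<close>.\<close>
  moreover have "det ?C1 = (\<Prod>k<n. x k) * (hsum {..<n} x t \<rho> t * ?V)"
  proof -
    let ?E = "mat n n (\<lambda>(i, j). if i = j then x i else 0)"
    let ?M = "mat n n (\<lambda>(i, j). x i ^ j - t * \<rho> i * (t * x i) ^ j)"
    have EM: "?C1 = ?E * ?M"
    proof (intro eq_matI)
      fix i j assume "i < dim_row (?E * ?M)" "j < dim_col (?E * ?M)"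
      then have ij: "i < n" "j < n" by auto
      have "(?E * ?M) $$ (i, j) = (\<Sum>k = 0..<n. ?E $$ (i, k) * ?M $$ (k, j))"
        using ij by (simp add: scalar_prod_def)
      also have "\<dots> = (\<Sum>k = 0..<n. if k = i then x i * (x i ^ j - t * \<rho> i * (t * x i) ^ j) else 0)"
        using ij by (intro sum.cong) auto
      finally show "?C1 $$ (i, j) = (?E * ?M) $$ (i, j)"
        using ij by (simp add: c_def algebra_simps)
    qed auto
    have "det ?E = (\<Prod>k<n. x k)"
      by (rule det_diagonal)
    moreover have "det (?E * ?M) = det ?E * det ?M"
      by (rule det_mult[of _ n]; simp)
    ultimately show ?thesis
      by (simp only: EM det_hsum[OF inj])
  qed
  ultimately have "((- 1) ^ n * (\<Prod>k<n. x k) * ?V) * hsum {..<n} x t \<rho> 1 =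
      ((- 1) ^ n * (\<Prod>k<n. x k) * ?V) * (a ^ n * hsum {..<n} x t \<rho> t)"
    by (simp add: Yn Y0 power_minus[of a] ac_simps)
  moreover have "(- 1) ^ n * (\<Prod>k<n. x k) * ?V \<noteq> 0" using V nz by simp
  ultimately show ?thesis by (simp only: mult_cancel_left) simp
qed

section \<open>The \<open>q\<close>-exponential series\<close>

text \<open>The q-Pochhammer symbol \<open>(t; t)_n\<close>.\<close>

definition qfact :: "'a::field \<Rightarrow> nat \<Rightarrow> 'a" where
  "qfact t n = (\<Prod>k<n. 1 - t ^ Suc k)"

text \<open>The substitution of \<open>c * X\<close> for \<open>X\<close>; for \<open>c = t\<close>
  it is the q-shift that characterises the series below.\<close>

definition fps_scale :: "'a::field \<Rightarrow> 'a fps \<Rightarrow> 'a fps" where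
  "fps_scale c F = Abs_fps (\<lambda>n. c ^ n * fps_nth F n)"

lemma fps_scale_nth [simp]: "fps_nth (fps_scale c F) n = c ^ n * fps_nth F n"
  by (simp add: fps_scale_def)

lemma fps_scale_mult: "fps_scale c (F * G) = fps_scale c F * fps_scale c G"
proof (rule fps_ext)
  fix n
  have "c ^ n * (fps_nth F i * fps_nth G (n - i)) = c ^ i * fps_nth F i * (c ^ (n - i) * fps_nth G (n - i))"
    if "i \<in> {0..n}" for i
  proof -
    have "c ^ n = c ^ i * c ^ (n - i)" using that by (simp flip: power_add)
    then show ?thesis by simp
  qed
  then show "fps_nth (fps_scale c (F * G)) n = fps_nth (fps_scale c F * fps_scale c G) n"
    unfolding fps_scale_nth fps_mult_nth sum_distrib_left by (rule sum.cong[OF refl])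
qed

lemma fps_scale_diff: "fps_scale c (F - G) = fps_scale c F - fps_scale c G"
  by (rule fps_ext) (simp add: algebra_simps)

lemma fps_scale_scale: "fps_scale c (fps_scale d F) = fps_scale (c * d) F"
  by (rule fps_ext) (simp add: power_mult_distrib)

lemma fps_scale_euler: "fps_scale c (fps_X * fps_deriv F) = fps_X * fps_deriv (fps_scale c F)"
  by (rule fps_ext) simp

text \<open>Euler's series for the inverse of the product of \<open>1 - t^k X\<close> over
  \<open>k \<ge> 0\<close>.\<close>

definition qexp :: "'a::field \<Rightarrow> 'a fps" where
  "qexp t = Abs_fps (\<lambda>n. 1 / qfact t n)"

text \<open>Euler's series for the product of \<open>1 - t^k X\<close> over
  \<open>k \<ge> 0\<close>.\<close>

definition qexp' :: "'a::field \<Rightarrow> 'a fps" where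
  "qexp' t = Abs_fps (\<lambda>n. (- 1) ^ n * t ^ (n choose 2) / qfact t n)"

text \<open>Generating series of the power sums of the letters
  \<open>1, t, t^2, ...\<close>.\<close>

definition qpow :: "'a::field \<Rightarrow> 'a fps" where
  "qpow t = Abs_fps (\<lambda>n. if n = 0 then 0 else 1 / (1 - t ^ n))"

context
  fixes t :: "'a::field"
  assumes t: "\<And>k. k > 0 \<Longrightarrow> t ^ k \<noteq> 1"
begin

lemma qfact_Suc: "qfact t (Suc n) = qfact t n * (1 - t ^ Suc n)"
  by (simp add: qfact_def)

text \<open>In product form the shift removes the factor with \<open>k = 0\<close>; on coefficients
  this is the recursion of \<open>qfact\<close>.\<close>

lemma qexp_scale: "fps_scale t (qexp t) = (1 - fps_X) * qexp t"
proof (rule fps_ext)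
  fix n
  show "fps_nth (fps_scale t (qexp t)) n = fps_nth ((1 - fps_X) * qexp t) n"
  proof (cases n)
    case (Suc m)
    define T where "T = t ^ Suc m"
    have "1 - T \<noteq> 0" using t[of "Suc m"] by (simp add: T_def)
    then have a: "fps_nth (qexp t) m = fps_nth (qexp t) (Suc m) * (1 - T)"
      by (simp add: qexp_def qfact_Suc T_def del: power_Suc)
    have "fps_nth ((1 - fps_X) * qexp t) n = fps_nth (qexp t) (Suc m) - fps_nth (qexp t) m"
      by (simp add: left_diff_distrib Suc)
    then show ?thesis
      unfolding a fps_scale_nth Suc T_def[symmetric] by (simp add: right_diff_distrib)
  qed (simp add: qexp_def qfact_def)
qed

lemma qexp'_scale: "qexp' t = (1 - fps_X) * fps_scale t (qexp' t)"
proof (rule fps_ext)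
  fix n
  show "fps_nth (qexp' t) n = fps_nth ((1 - fps_X) * fps_scale t (qexp' t)) n"
  proof (cases n)
    case (Suc m)
    define T where "T = t ^ Suc m"
    have nz: "1 - T \<noteq> 0" using t[of "Suc m"] by (simp add: T_def)
    have c: "Suc m choose 2 = (m choose 2) + m" by (simp add: numeral_2_eq_2)
    have "fps_nth (qexp' t) (Suc m) * (1 - T) = - (t ^ m * fps_nth (qexp' t) m)"
      using nz by (simp add: qexp'_def qfact_Suc c power_add power_Suc[of "- 1"]
          T_def[symmetric] del: power_Suc)
    then have "fps_nth (qexp' t) (Suc m) = T * fps_nth (qexp' t) (Suc m) - t ^ m * fps_nth (qexp' t) m"
      by (simp add: algebra_simps)
    moreover have "fps_nth ((1 - fps_X) * fps_scale t (qexp' t)) n =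
        T * fps_nth (qexp' t) (Suc m) - t ^ m * fps_nth (qexp' t) m"
      by (simp add: left_diff_distrib Suc T_def del: power_Suc)
    ultimately show ?thesis by (simp add: Suc)
  qed (simp add: qexp'_def qfact_def)
qed

text \<open>The product is invariant under the shift, which multiplies its coefficient of degree
  \<open>n\<close> by \<open>t ^ n\<close>. As this is not 1 for \<open>n > 0\<close>, only the
  constant coefficient survives.\<close>

lemma qexp'_mult_qexp: "qexp' t * qexp t = 1"
proof (rule fps_ext)
  fix n
  have "fps_scale t (qexp' t * qexp t) = ((1 - fps_X) * fps_scale t (qexp' t)) * qexp t"
    by (simp only: fps_scale_mult qexp_scale) (simp add: ac_simps)
  also have "\<dots> = qexp' t * qexp t"
    by (simp only: qexp'_scale[symmetric])
  finally have "fps_nth (fps_scale t (qexp' t * qexp t)) n = fps_nth (qexp' t * qexp t) n"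
    by (rule arg_cong)
  then have "t ^ n * fps_nth (qexp' t * qexp t) n = fps_nth (qexp' t * qexp t) n"
    by (simp only: fps_scale_nth)
  then have "n > 0 \<Longrightarrow> fps_nth (qexp' t * qexp t) n = 0"
    using t[of n] by simp
  then show "fps_nth (qexp' t * qexp t) n = fps_nth 1 n"
    by (cases "n = 0") (auto simp: qexp_def qexp'_def qfact_def numeral_2_eq_2)
qed

lemma qpow_scale: "(1 - fps_X) * fps_scale t (qpow t) = (1 - fps_X) * qpow t - fps_X"
proof -
  have *: "qpow t - fps_scale t (qpow t) = Abs_fps (\<lambda>n. of_bool (n > 0))"
    using t by (intro fps_ext) (auto simp: qpow_def divide_simps)
  have "(1 - fps_X) * (qpow t - fps_scale t (qpow t)) = fps_X"
    unfolding * by (intro fps_ext) (auto simp: algebra_simps fps_X_nth)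
  then have "(1 - fps_X) * qpow t = fps_X + (1 - fps_X) * fps_scale t (qpow t)"
    unfolding right_diff_distrib by (rule diff_eq_eq[THEN iffD1])
  then show ?thesis by simp
qed

text \<open>Newton's identities between complete and power sums. The defect \<open>G\<close>
  satisfies the shift equation of \<open>qexp t\<close> with constant coefficient 0, which forces
  \<open>G = 0\<close> because no positive power of \<open>t\<close> is 1.\<close>

lemma qexp_newton: "fps_X * fps_deriv (qexp t) = qpow t * qexp t"
proof -
  define G where "G = fps_X * fps_deriv (qexp t) - qpow t * qexp t"
  have "fps_scale t G = fps_X * fps_deriv ((1 - fps_X) * qexp t)
      - ((1 - fps_X) * fps_scale t (qpow t)) * qexp t"
    by (simp only: G_def fps_scale_diff fps_scale_mult[of _ "qpow t"] fps_scale_euler qexp_scale)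
      (simp add: ac_simps)
  also have "\<dots> = (1 - fps_X) * G"
    unfolding qpow_scale G_def by (simp add: algebra_simps)
  finally have "fps_nth (fps_scale t G) n = fps_nth ((1 - fps_X) * G) n" for n
    by simp
  then have G: "t ^ n * fps_nth G n = fps_nth ((1 - fps_X) * G) n" for n
    by (simp only: fps_scale_nth)
  have "fps_nth G n = 0" for n
  proof (induction n)
    case 0
    show ?case by (simp add: G_def qpow_def)
  next
    case (Suc n)
    have "t ^ Suc n * fps_nth G (Suc n) = fps_nth G (Suc n)"
      using G[of "Suc n"] Suc by (simp add: algebra_simps del: power_Suc)
    then show ?case using t[of "Suc n"] by simp
  qed
  then have "G = 0" by (intro fps_ext) simp
  then show ?thesis by (simp add: G_def)
qed

end

text \<open>Generating series of the complete symmetric functions \<open>h\<^sub>n\<close> of the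
  letters \<open>q^k\<close> with \<open>k \<ge> 1\<close> and \<open>t^k\<close> with
  \<open>k \<ge> 0\<close>.\<close>

definition hseries :: "'a::field \<Rightarrow> 'a \<Rightarrow> 'a fps" where
  "hseries q t = fps_scale q (qexp q) * qexp t"

context
  fixes q t :: "'a::field"
  assumes q: "\<And>k. k > 0 \<Longrightarrow> q ^ k \<noteq> 1" and t: "\<And>k. k > 0 \<Longrightarrow> t ^ k \<noteq> 1"
begin

text \<open>Logarithmic derivatives add up, and \<open>q^k / (1 - q^k) + 1 / (1 - t^k)\<close> is
  the fraction in the sum.\<close>

lemma hseries_newton:
  "of_nat n * fps_nth (hseries q t) n =
    (\<Sum>k=1..n. (1 - q ^ k * t ^ k) / ((1 - q ^ k) * (1 - t ^ k)) * fps_nth (hseries q t) (n - k))"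
proof -
  have "fps_X * fps_deriv (hseries q t) =
      fps_scale q (fps_X * fps_deriv (qexp q)) * qexp t + fps_scale q (qexp q) * (fps_X * fps_deriv (qexp t))"
    by (simp add: hseries_def fps_scale_euler algebra_simps)
  also have "\<dots> = (fps_scale q (qpow q) + qpow t) * hseries q t"
    by (simp only: qexp_newton[OF q] qexp_newton[OF t] fps_scale_mult[of q "qpow q"] hseries_def)
      (simp add: algebra_simps)
  finally have "fps_nth (fps_X * fps_deriv (hseries q t)) n =
      fps_nth ((fps_scale q (qpow q) + qpow t) * hseries q t) n"
    by (rule arg_cong)
  then have "of_nat n * fps_nth (hseries q t) n =
      fps_nth ((fps_scale q (qpow q) + qpow t) * hseries q t) n"
    by (simp only: fps_mult_fps_X_deriv_shift fps_nth_Abs_fps)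
  also have "\<dots> = (\<Sum>k=0..n. fps_nth (fps_scale q (qpow q) + qpow t) k * fps_nth (hseries q t) (n - k))"
    by (simp add: fps_mult_nth)
  also have "\<dots> = (\<Sum>k=1..n. fps_nth (fps_scale q (qpow q) + qpow t) k * fps_nth (hseries q t) (n - k))"
    by (rule sum.mono_neutral_right) (auto simp: qpow_def)
  also have "\<dots> = (\<Sum>k=1..n. (1 - q ^ k * t ^ k) / ((1 - q ^ k) * (1 - t ^ k)) * fps_nth (hseries q t) (n - k))"
  proof (rule sum.cong[OF refl])
    fix k assume "k \<in> {1..n}"
    then have "1 - q ^ k \<noteq> 0" "1 - t ^ k \<noteq> 0" "k > 0" using q[of k] t[of k] by auto
    then have "fps_nth (fps_scale q (qpow q) + qpow t) k = (1 - q ^ k * t ^ k) / ((1 - q ^ k) * (1 - t ^ k))"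
      by (simp add: qpow_def add_frac_eq) (simp add: algebra_simps)
    then show "fps_nth (fps_scale q (qpow q) + qpow t) k * fps_nth (hseries q t) (n - k) =
        (1 - q ^ k * t ^ k) / ((1 - q ^ k) * (1 - t ^ k)) * fps_nth (hseries q t) (n - k)" by simp
  qed
  finally show ?thesis .
qed

text \<open>Multiplying \<open>hseries q t\<close> by \<open>qexp' t\<close> leaves
  \<open>qexp q\<close> at \<open>q X\<close>; multiplying its shift by \<open>q\<close> with
  \<open>qexp' t\<close> at \<open>q t X\<close> leaves the same series. The identity compares
  coefficients of degree \<open>n\<close>.\<close>

lemma hseries_rec:
  "(\<Sum>r\<le>n. (- 1) ^ r * t ^ (r choose 2) / qfact t r * (1 - q ^ n * t ^ r) * fps_nth (hseries q t) (n - r)) = 0"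
proof -
  have "(1 - fps_X) * (fps_scale t (qexp' t) * qexp t) = ((1 - fps_X) * fps_scale t (qexp' t)) * qexp t"
    by (simp only: mult.assoc)
  also have "\<dots> = 1"
    by (simp only: qexp'_scale[OF t, symmetric] qexp'_mult_qexp[OF t])
  finally have W: "(1 - fps_X) * (fps_scale t (qexp' t) * qexp t) = 1" .
  have "fps_scale (q * t) (qexp' t) * fps_scale q (hseries q t) =
      fps_scale q (fps_scale t (qexp' t) * (((1 - fps_X) * qexp q) * qexp t))"
    by (simp only: hseries_def qexp_scale[OF q]) (simp only: fps_scale_mult fps_scale_scale)
  also have "fps_scale t (qexp' t) * (((1 - fps_X) * qexp q) * qexp t) =
      ((1 - fps_X) * (fps_scale t (qexp' t) * qexp t)) * qexp q"
    by (simp only: mult.assoc mult.left_commute mult.commute)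
  also have "fps_scale q \<dots> = qexp' t * qexp t * fps_scale q (qexp q)"
    by (simp only: W qexp'_mult_qexp[OF t] mult_1_left)
  also have "\<dots> = qexp' t * hseries q t"
    unfolding hseries_def by (simp only: mult.assoc mult.left_commute mult.commute)
  finally have "fps_nth (qexp' t * hseries q t) n - fps_nth (fps_scale (q * t) (qexp' t) * fps_scale q (hseries q t)) n = 0"
    by simp
  then have "(\<Sum>r\<le>n. fps_nth (qexp' t) r * fps_nth (hseries q t) (n - r) -
      fps_nth (fps_scale (q * t) (qexp' t)) r * fps_nth (fps_scale q (hseries q t)) (n - r)) = 0"
    by (simp only: fps_mult_nth sum_subtractf atLeast0AtMost)
  moreover have "fps_nth (qexp' t) r * fps_nth (hseries q t) (n - r) -
      fps_nth (fps_scale (q * t) (qexp' t)) r * fps_nth (fps_scale q (hseries q t)) (n - r) =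
      (- 1) ^ r * t ^ (r choose 2) / qfact t r * (1 - q ^ n * t ^ r) * fps_nth (hseries q t) (n - r)"
    if "r \<in> {..n}" for r
  proof -
    define e where "e = fps_nth (qexp' t) r"
    have "(- 1) ^ r * t ^ (r choose 2) / qfact t r = e"
      by (simp add: qexp'_def e_def)
    moreover have "q ^ n = q ^ r * q ^ (n - r)" using that by (simp flip: power_add)
    ultimately show ?thesis by (simp add: power_mult_distrib algebra_simps flip: e_def)
  qed
  ultimately show ?thesis
    by (metis (no_types, lifting) sum.cong)
qed

lemma hseries_0: "fps_nth (hseries q t) 0 = 1"
  by (simp add: hseries_def qexp_def qfact_def)

end

lemma hseries_at_0: "fps_nth (hseries 0 t) n = 1 / qfact t n"
proof -
  have "fps_scale 0 (qexp (0 :: 'a)) = 1"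
    by (rule fps_ext) (auto simp: qexp_def qfact_def power_0_left)
  then show ?thesis by (simp add: hseries_def qexp_def)
qed

section \<open>The subset identity for the weight functions\<close>

text \<open>Determinants need rows numbered from 0, whereas the recursion for constant terms runs
  over subsets of an index set.\<close>

lemma hsum_reindex:
  assumes h: "bij_betw h M N"
  shows "hsum N x t \<rho> u = hsum M (x \<circ> h) t (\<rho> \<circ> h) u"
proof -
  have inj: "inj_on h B" if "B \<subseteq> M" for B
    using h that by (auto simp: bij_betw_def intro: inj_on_subset)
  have diff: "N - h ` B = h ` (M - B)" if "B \<subseteq> M" for B
    using h that by (auto simp: bij_betw_def inj_on_def)
  show ?thesis
    unfolding hsum_def
  proof (subst sum.reindex_bij_betw[OF bij_betw_Pow[OF h], symmetric], rule sum.cong[OF refl])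
    fix B assume "B \<in> Pow M"
    then have B: "B \<subseteq> M" by simp
    show "(- u) ^ card (h ` B) * t ^ (card (h ` B) choose 2) * prod \<rho> (h ` B) *
        (\<Prod>i\<in>h ` B. \<Prod>j\<in>N - h ` B. (x j - t * x i) / (x j - x i)) =
      (- u) ^ card B * t ^ (card B choose 2) * prod (\<rho> \<circ> h) B *
        (\<Prod>i\<in>B. \<Prod>j\<in>M - B. ((x \<circ> h) j - t * (x \<circ> h) i) / ((x \<circ> h) j - (x \<circ> h) i))"
      by (simp add: card_image[OF inj[OF B]] diff[OF B] prod.reindex[OF inj[OF B]]
          prod.reindex[OF inj[OF Diff_subset]])
  qed
qed

text \<open>The two sides of \<open>hsum_duality\<close> are subtracted: at each \<open>B\<close>
  the terms for \<open>u = 1\<close> and \<open>u = t\<close> differ by the factor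
  \<open>a ^ card N * t ^ card B\<close>.\<close>

lemma subset_sum_identity:
  fixes x :: "'i \<Rightarrow> 'a::field"
  assumes fin: "finite N" and ne: "N \<noteq> {}" and inj: "inj_on x N" and nz: "\<And>i. i \<in> N \<Longrightarrow> x i \<noteq> 0"
    and den: "\<And>i k. i \<in> N \<Longrightarrow> k \<in> N \<Longrightarrow> x k - a * t * x i \<noteq> 0"
  defines "\<rho> \<equiv> \<lambda>i. \<Prod>k\<in>N. (x k - a * x i) / (x k - a * t * x i)"
  shows "(\<Sum>B\<in>Pow N. (- 1) ^ card B * t ^ (card B choose 2) * (1 - a ^ card N * t ^ card B) *
    ((\<Prod>i\<in>B. \<rho> i) * (\<Prod>i\<in>B. \<Prod>j\<in>N - B. (x j - t * x i) / (x j - x i)))) = 0"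
proof -
  obtain h where h: "bij_betw h {..<card N} N"
    using ex_bij_betw_nat_finite[OF fin] by (auto simp: atLeast0LessThan)
  have hN: "h i \<in> N" if "i < card N" for i using h that by (auto simp: bij_betw_def)
  have "\<rho> (h i) = (\<Prod>k<card N. (x (h k) - a * x (h i)) / (x (h k) - a * t * x (h i)))" for i
    unfolding \<rho>_def by (rule prod.reindex_bij_betw[OF h, symmetric])
  then have \<rho>: "\<rho> \<circ> h = (\<lambda>i. \<Prod>k<card N. ((x \<circ> h) k - a * (x \<circ> h) i) / ((x \<circ> h) k - a * t * (x \<circ> h) i))"
    by (simp add: fun_eq_iff)
  have "hsum {..<card N} (x \<circ> h) t (\<rho> \<circ> h) 1 = a ^ card N * hsum {..<card N} (x \<circ> h) t (\<rho> \<circ> h) t"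
    unfolding \<rho>
  proof (rule hsum_duality)
    show "inj_on (x \<circ> h) {..<card N}"
      using h inj by (intro comp_inj_on) (auto simp: bij_betw_def)
    show "0 < card N" using fin ne by (simp add: card_gt_0_iff)
  qed (use hN nz den in auto)
  then have "hsum N x t \<rho> 1 - a ^ card N * hsum N x t \<rho> t = 0"
    by (simp add: hsum_reindex[OF h])
  moreover have "hsum N x t \<rho> 1 - a ^ card N * hsum N x t \<rho> t =
    (\<Sum>B\<in>Pow N. (- 1) ^ card B * t ^ (card B choose 2) * (1 - a ^ card N * t ^ card B) *
    ((\<Prod>i\<in>B. \<rho> i) * (\<Prod>i\<in>B. \<Prod>j\<in>N - B. (x j - t * x i) / (x j - x i))))"
    unfolding hsum_def sum_distrib_left sum_subtractf[symmetric]
  proof (rule sum.cong[OF refl])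
    fix B :: "'i set"
    have "(- t) ^ card B = (- 1) ^ card B * t ^ card B"
      by (rule power_minus)
    then show "(- 1) ^ card B * t ^ (card B choose 2) * prod \<rho> B *
          (\<Prod>i\<in>B. \<Prod>j\<in>N - B. (x j - t * x i) / (x j - x i)) -
        a ^ card N * ((- t) ^ card B * t ^ (card B choose 2) * prod \<rho> B *
          (\<Prod>i\<in>B. \<Prod>j\<in>N - B. (x j - t * x i) / (x j - x i))) =
        (- 1) ^ card B * t ^ (card B choose 2) * (1 - a ^ card N * t ^ card B) *
        (prod \<rho> B * (\<Prod>i\<in>B. \<Prod>j\<in>N - B. (x j - t * x i) / (x j - x i)))"
      by (simp only: algebra_simps mult_1_left)
  qed
  ultimately show ?thesis by simp
qed

definition offdiag_prod :: "'i set \<Rightarrow> ('i \<Rightarrow> 'i \<Rightarrow> 'a::comm_monoid_mult) \<Rightarrow> 'a" where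
  "offdiag_prod N f = (\<Prod>i\<in>N. \<Prod>j\<in>N - {i}. f i j)"

text \<open>Mixed ordered pairs come in both orientations, and both are listed under their member in
  \<open>B\<close>.\<close>

lemma offdiag_prod_split:
  assumes fin: "finite N" and B: "B \<subseteq> N"
  shows "offdiag_prod N f =
    offdiag_prod B f * offdiag_prod (N - B) f * (\<Prod>i\<in>B. \<Prod>j\<in>N - B. f i j * f j i)"
proof -
  have finB: "finite B" using fin B by (rule finite_subset[rotated])
  have 1: "(\<Prod>j\<in>N - {i}. f i j) = (\<Prod>j\<in>B - {i}. f i j) * (\<Prod>j\<in>N - B. f i j)" if "i \<in> B" for i
  proof -
    have "N - {i} = (B - {i}) \<union> (N - B)" using that B by auto
    then show ?thesis using fin finB by (auto intro: prod.union_disjoint)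
  qed
  have 2: "(\<Prod>j\<in>N - {i}. f i j) = (\<Prod>j\<in>N - B - {i}. f i j) * (\<Prod>j\<in>B. f i j)" if "i \<in> N - B" for i
  proof -
    have "N - {i} = (N - B - {i}) \<union> B" using that B by auto
    then show ?thesis using fin finB by (auto intro: prod.union_disjoint)
  qed
  have "offdiag_prod N f = (\<Prod>i\<in>N - B. \<Prod>j\<in>N - {i}. f i j) * (\<Prod>i\<in>B. \<Prod>j\<in>N - {i}. f i j)"
    unfolding offdiag_prod_def using B fin by (rule prod.subset_diff)
  also have "\<dots> = (offdiag_prod (N - B) f * (\<Prod>i\<in>N - B. \<Prod>j\<in>B. f i j)) *
      (offdiag_prod B f * (\<Prod>i\<in>B. \<Prod>j\<in>N - B. f i j))"
    by (simp only: prod.cong[OF refl 1] prod.cong[OF refl 2] prod.distrib offdiag_prod_def)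
  also have "(\<Prod>i\<in>N - B. \<Prod>j\<in>B. f i j) = (\<Prod>i\<in>B. \<Prod>j\<in>N - B. f j i)"
    by (rule prod.swap)
  finally show ?thesis by (simp add: prod.distrib ac_simps)
qed

lemma offdiag_prod_mult: "offdiag_prod N (\<lambda>i j. f i j * g i j) = offdiag_prod N f * offdiag_prod N g"
  by (simp add: offdiag_prod_def prod.distrib)

lemma offdiag_prod_cong:
  "(\<And>i j. i \<in> N \<Longrightarrow> j \<in> N \<Longrightarrow> i \<noteq> j \<Longrightarrow> f i j = g i j) \<Longrightarrow> offdiag_prod N f = offdiag_prod N g"
  by (auto simp: offdiag_prod_def intro!: prod.cong)

text \<open>This is \<open>subset_sum_identity\<close> times the weight product over
  \<open>N\<close>. Inside \<open>B\<close> the factors of \<open>\<rho>\<close> turn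
  \<open>w a\<close> into \<open>w 0\<close>; between \<open>B\<close> and its complement they
  cancel, together with the difference quotients, one of the two orientations.\<close>

lemma offdiag_identity:
  fixes x :: "'i \<Rightarrow> 'a::field"
  assumes fin: "finite N" and ne: "N \<noteq> {}" and inj: "inj_on x N" and nz: "\<And>i. i \<in> N \<Longrightarrow> x i \<noteq> 0"
    and at: "\<And>i k. i \<in> N \<Longrightarrow> k \<in> N \<Longrightarrow> x k - a * t * x i \<noteq> 0"
    and a: "\<And>i k. i \<in> N \<Longrightarrow> k \<in> N \<Longrightarrow> x k - a * x i \<noteq> 0"
    and t: "\<And>i k. i \<in> N \<Longrightarrow> k \<in> N \<Longrightarrow> x k - t * x i \<noteq> 0"
  defines "w \<equiv> \<lambda>a i j. (1 - a * t * (x i / x j)) * (1 - x i / x j) / ((1 - a * (x i / x j)) * (1 - t * (x i / x j)))"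
  shows "(\<Sum>B\<in>Pow N. (- 1) ^ card B * t ^ (card B choose 2) * (1 - a ^ card N * t ^ card B) *
    ((1 - a) ^ card B * (1 - a * t) ^ card (N - B)) *
    (offdiag_prod B (w 0) * offdiag_prod (N - B) (w a) * (\<Prod>i\<in>B. \<Prod>j\<in>N - B. w a j i))) = 0"
proof -
  \<comment> \<open>\<open>s\<close> gives the factors of \<open>\<rho>\<close>, and
    \<open>d\<close> those of the double product in \<open>subset_sum_identity\<close>.\<close>
  define s where "s = (\<lambda>i j. (x j - a * x i) / (x j - a * t * x i))"
  define d where "d = (\<lambda>i j. (x j - t * x i) / (x j - x i))"
  obtain i0 where "i0 \<in> N" using ne by auto
  have at1: "1 - a * t \<noteq> 0" using at[OF \<open>i0 \<in> N\<close> \<open>i0 \<in> N\<close>] by auto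
  have wform: "w b i j = (x j - b * t * x i) * (x j - x i) / ((x j - b * x i) * (x j - t * x i))"
    if "j \<in> N" for b i j
  proof -
    have e: "1 - c * (x i / x j) = (x j - c * x i) / x j" for c
      using nz[OF that] by (simp add: diff_divide_distrib)
    show ?thesis
      unfolding w_def e using e[of 1] nz[OF that] by simp
  qed
  have ws: "w a i j * s i j = w 0 i j" if "i \<in> N" "j \<in> N" for i j
    using at[OF that] a[OF that] nz[OF that(2)] unfolding wform[OF that(2)] s_def by simp
  have wsd: "w a i j * s i j * d i j = 1" if "i \<in> N" "j \<in> N" "i \<noteq> j" for i j
  proof -
    have "x j - x i \<noteq> 0" using inj that by (auto simp: inj_on_def)
    then show ?thesis
      unfolding ws[OF that(1,2)] unfolding wform[OF that(2)] d_def using t[OF that(1,2)] nz[OF that(2)] by simp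
  qed
  \<comment> \<open>The product \<open>\<rho> i\<close> includes \<open>k = i\<close>; these
    diagonal factors account for the powers of \<open>1 - a\<close> and
    \<open>1 - a * t\<close>.\<close>
  have sii: "s i i = (1 - a) / (1 - a * t)" if "i \<in> N" for i
  proof -
    have "x i - a * x i = (1 - a) * x i" "x i - a * t * x i = (1 - a * t) * x i"
      by (simp_all add: left_diff_distrib)
    then show ?thesis using nz[OF that] by (simp add: s_def)
  qed
  have key: "offdiag_prod N (w a) * (1 - a * t) ^ card N *
      ((\<Prod>i\<in>B. \<Prod>k\<in>N. s i k) * (\<Prod>i\<in>B. \<Prod>j\<in>N - B. d i j)) =
    (1 - a) ^ card B * (1 - a * t) ^ card (N - B) *
    (offdiag_prod B (w 0) * offdiag_prod (N - B) (w a) * (\<Prod>i\<in>B. \<Prod>j\<in>N - B. w a j i))"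
    if B: "B \<subseteq> N" for B
  proof -
    have finB: "finite B" using fin B by (rule finite_subset[rotated])
    have S: "(\<Prod>k\<in>N. s i k) = (1 - a) / (1 - a * t) * (\<Prod>k\<in>B - {i}. s i k) * (\<Prod>k\<in>N - B. s i k)"
      if i: "i \<in> B" for i
    proof -
      have "(\<Prod>k\<in>N. s i k) = (\<Prod>k\<in>N - B. s i k) * (\<Prod>k\<in>B. s i k)"
        using B fin by (rule prod.subset_diff)
      also have "(\<Prod>k\<in>B. s i k) = s i i * (\<Prod>k\<in>B - {i}. s i k)"
        using finB i by (rule prod.remove)
      also have "s i i = (1 - a) / (1 - a * t)" using i B by (intro sii) auto
      finally show ?thesis by (simp only: ac_simps)
    qed
    have e1: "(\<Prod>i\<in>B. \<Prod>k\<in>N. s i k) =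
        ((1 - a) / (1 - a * t)) ^ card B * offdiag_prod B s * (\<Prod>i\<in>B. \<Prod>k\<in>N - B. s i k)"
      by (simp only: prod.cong[OF refl S] prod.distrib offdiag_prod_def prod_constant)
    have e2: "(1 - a * t) ^ card N * ((1 - a) / (1 - a * t)) ^ card B =
        (1 - a) ^ card B * (1 - a * t) ^ card (N - B)"
    proof -
      have "card N = card B + card (N - B)"
        using card_mono[OF fin B] finB B by (simp add: card_Diff_subset)
      then show ?thesis using at1 by (simp add: power_add power_divide)
    qed
    have e3: "offdiag_prod B (w a) * offdiag_prod B s = offdiag_prod B (w 0)"
      unfolding offdiag_prod_mult[symmetric] using B by (intro offdiag_prod_cong ws) auto
    have e4: "(\<Prod>i\<in>B. \<Prod>j\<in>N - B. w a i j * w a j i) * (\<Prod>i\<in>B. \<Prod>k\<in>N - B. s i k) *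
        (\<Prod>i\<in>B. \<Prod>j\<in>N - B. d i j) = (\<Prod>i\<in>B. \<Prod>j\<in>N - B. w a j i)"
      unfolding prod.distrib[symmetric]
    proof (intro prod.cong refl)
      fix i j assume "i \<in> B" "j \<in> N - B"
      then have "w a i j * s i j * d i j = 1" using B by (intro wsd) auto
      then show "w a i j * w a j i * s i j * d i j = w a j i"
        by (metis (no_types, opaque_lifting) mult.assoc mult.commute mult.right_neutral)
    qed
    have "offdiag_prod N (w a) * (1 - a * t) ^ card N *
        ((\<Prod>i\<in>B. \<Prod>k\<in>N. s i k) * (\<Prod>i\<in>B. \<Prod>j\<in>N - B. d i j)) =
      ((1 - a * t) ^ card N * ((1 - a) / (1 - a * t)) ^ card B) *
      ((offdiag_prod B (w a) * offdiag_prod B s) * offdiag_prod (N - B) (w a) *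
       ((\<Prod>i\<in>B. \<Prod>j\<in>N - B. w a i j * w a j i) * (\<Prod>i\<in>B. \<Prod>k\<in>N - B. s i k) *
        (\<Prod>i\<in>B. \<Prod>j\<in>N - B. d i j)))"
      unfolding offdiag_prod_split[OF fin B] e1 by (simp only: ac_simps)
    then show ?thesis unfolding e2 e3 e4 .
  qed
  have "offdiag_prod N (w a) * (1 - a * t) ^ card N *
    (\<Sum>B\<in>Pow N. (- 1) ^ card B * t ^ (card B choose 2) * (1 - a ^ card N * t ^ card B) *
    ((\<Prod>i\<in>B. \<Prod>k\<in>N. s i k) * (\<Prod>i\<in>B. \<Prod>j\<in>N - B. d i j))) = 0"
    unfolding s_def d_def by (subst subset_sum_identity[OF fin ne inj nz at]) simp_all
  then show ?thesis
    unfolding sum_distrib_left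
  proof (rule trans[rotated], intro sum.cong refl)
    fix B assume "B \<in> Pow N"
    then have "B \<subseteq> N" by simp
    show "(- 1) ^ card B * t ^ (card B choose 2) * (1 - a ^ card N * t ^ card B) *
        ((1 - a) ^ card B * (1 - a * t) ^ card (N - B)) *
        (offdiag_prod B (w 0) * offdiag_prod (N - B) (w a) * (\<Prod>i\<in>B. \<Prod>j\<in>N - B. w a j i)) =
      offdiag_prod N (w a) * (1 - a * t) ^ card N *
        ((- 1) ^ card B * t ^ (card B choose 2) * (1 - a ^ card N * t ^ card B) *
        ((\<Prod>i\<in>B. \<Prod>k\<in>N. s i k) * (\<Prod>i\<in>B. \<Prod>j\<in>N - B. d i j)))"
      (is "?c * ?p * ?q = ?u * (?c * ?v)")
    proof -
      have "?c * ?p * ?q = ?c * (?p * ?q)" by (rule mult.assoc)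
      also have "?p * ?q = ?u * ?v" by (rule key[OF \<open>B \<subseteq> N\<close>, symmetric])
      also have "?c * (?u * ?v) = ?u * (?c * ?v)" by (rule mult.left_commute)
      finally show ?thesis .
    qed
  qed
qed

section \<open>Supports and constant terms\<close>

lemma coeff2_mult: "coeff2 (F * G) i j =
    (\<Sum>j'=0..j. \<Sum>i'=0..i. coeff2 F i' j' * coeff2 G (i - i') (j - j'))"
  by (simp add: coeff2_def fps_mult_nth fps_sum_nth)

lemma coeff2_add [simp]: "coeff2 (F + G) i j = coeff2 F i j + coeff2 G i j"
  and coeff2_diff [simp]: "coeff2 (F - G) i j = coeff2 F i j - coeff2 G i j"
  by (simp_all add: coeff2_def)

lemma fps2_eqI: "(\<And>i j. coeff2 F i j = coeff2 G i j) \<Longrightarrow> F = G"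
  by (intro fps_ext) (simp add: coeff2_def)

lemma coeff2_00_mult: "coeff2 (F * G) 0 0 = coeff2 F 0 0 * coeff2 G 0 0"
  by (simp add: coeff2_mult)

lemma coeff2_00_power: "coeff2 (F ^ n) 0 0 = coeff2 F 0 0 ^ n"
  for F :: "'a::comm_ring_1 fps2"
  by (induction n) (simp_all add: coeff2_00_mult, simp add: coeff2_def)

lemma coeff2_00_simps [simp]:
  "coeff2 (qvar :: 'a::comm_ring_1 fps2) 0 0 = 0" "coeff2 (tvar :: 'a fps2) 0 0 = 0"
  "coeff2 (1 :: 'a fps2) 0 0 = 1" "coeff2 (0 :: 'a fps2) 0 0 = 0"
  by (simp_all add: coeff2_def qvar_def tvar_def)

lemma quot2_mult_cancel: "coeff2 B 0 0 = 1 \<Longrightarrow> quot2 A B * B = A"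
  by (rule quot2_unique[THEN iffD2]) simp_all

lemma quot2_eqI: "coeff2 B 0 0 = 1 \<Longrightarrow> F * B = A \<Longrightarrow> quot2 A B = F"
  by (rule sym, rule quot2_unique[THEN iffD1])

text \<open>In the fraction field the power series expansion becomes an ordinary quotient, so that
  the field identities above apply.\<close>

lemma to_fract_quot2:
  assumes "coeff2 B 0 0 = (1 :: 'a::idom)"
  shows "to_fract (quot2 A B) = to_fract A / to_fract B"
proof -
  have "B \<noteq> 0" using assms by auto
  moreover have "to_fract (quot2 A B) * to_fract B = to_fract A"
    by (simp add: quot2_mult_cancel[OF assms] flip: to_fract_mult)
  ultimately show ?thesis by (simp add: eq_divide_eq)
qed

section \<open>Supports of series\<close>

definition supp2 :: "weight set \<Rightarrow> (weight \<Rightarrow>\<^sub>0 int) fps2 set" where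
  "supp2 S = {F. \<forall>i j. Poly_Mapping.keys (coeff2 F i j) \<subseteq> S}"

lemma supp2_mono: "F \<in> supp2 S \<Longrightarrow> S \<subseteq> T \<Longrightarrow> F \<in> supp2 T"
  unfolding supp2_def by blast

lemma keys_sum_subset:
  "(\<And>i. i \<in> I \<Longrightarrow> Poly_Mapping.keys (f i) \<subseteq> U) \<Longrightarrow> Poly_Mapping.keys (sum f I) \<subseteq> U"
  using keys_sum[of f I] by blast

lemma keys_add_subset:
  "Poly_Mapping.keys f \<subseteq> S \<Longrightarrow> Poly_Mapping.keys g \<subseteq> S \<Longrightarrow> Poly_Mapping.keys (f + g) \<subseteq> S"
  using keys_add[of f g] by blast

lemma keys_diff_subset:
  "Poly_Mapping.keys f \<subseteq> S \<Longrightarrow> Poly_Mapping.keys g \<subseteq> S \<Longrightarrow> Poly_Mapping.keys (f - g) \<subseteq> S"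
  using keys_diff[of f g] by blast

lemma keys_mult_subset:
  assumes "Poly_Mapping.keys f \<subseteq> S" "Poly_Mapping.keys g \<subseteq> T"
    and "\<And>a b. a \<in> S \<Longrightarrow> b \<in> T \<Longrightarrow> a + b \<in> U"
  shows "Poly_Mapping.keys (f * g) \<subseteq> U"
proof
  fix x assume "x \<in> Poly_Mapping.keys (f * g)"
  then obtain a b where "x = a + b" "a \<in> Poly_Mapping.keys f" "b \<in> Poly_Mapping.keys g"
    using keys_mult[of f g] by blast
  then show "x \<in> U" using assms by (simp add: subsetD)
qed

lemma supp2_mult:
  assumes F: "F \<in> supp2 S" and G: "G \<in> supp2 T" and ST: "\<And>a b. a \<in> S \<Longrightarrow> b \<in> T \<Longrightarrow> a + b \<in> U"
  shows "F * G \<in> supp2 U"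
proof -
  have "Poly_Mapping.keys (coeff2 F i j * coeff2 G i' j') \<subseteq> U" for i j i' j'
    using F G by (intro keys_mult_subset[OF _ _ ST]) (simp_all add: supp2_def)
  then have "Poly_Mapping.keys (coeff2 (F * G) i j) \<subseteq> U" for i j
    unfolding coeff2_mult by (intro keys_sum_subset)
  then show ?thesis by (simp add: supp2_def)
qed

lemma supp2_add: "F \<in> supp2 S \<Longrightarrow> G \<in> supp2 S \<Longrightarrow> F + G \<in> supp2 S"
  by (simp add: supp2_def keys_add_subset)

lemma supp2_diff: "F \<in> supp2 S \<Longrightarrow> G \<in> supp2 S \<Longrightarrow> F - G \<in> supp2 S"
  by (simp add: supp2_def keys_diff_subset)

definition add_submonoid :: "weight set \<Rightarrow> bool" where
  "add_submonoid S \<longleftrightarrow> 0 \<in> S \<and> (\<forall>a\<in>S. \<forall>b\<in>S. a + b \<in> S)"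

text \<open>The elements of the group ring supported on a submonoid form a subring;
  \<open>fps_coeffs_subring\<close> is applied twice, first for \<open>q\<close> and then for
  \<open>t\<close>.\<close>

lemma supp2_closed:
  assumes S: "add_submonoid S"
  shows supp2_one: "1 \<in> supp2 S"
    and supp2_times: "\<And>F G. F \<in> supp2 S \<Longrightarrow> G \<in> supp2 S \<Longrightarrow> F * G \<in> supp2 S"
    and supp2_quot2: "\<And>F G. F \<in> supp2 S \<Longrightarrow> G \<in> supp2 S \<Longrightarrow> quot2 F G \<in> supp2 S"
    and supp2_qvar: "qvar \<in> supp2 S" and supp2_tvar: "tvar \<in> supp2 S"
    and supp2_e_exp: "\<And>\<alpha>. \<alpha> \<in> S \<Longrightarrow> e_exp \<alpha> \<in> supp2 S"
proof -
  define R where "R = {f :: weight \<Rightarrow>\<^sub>0 int. Poly_Mapping.keys f \<subseteq> S}"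
  define T where "T = {F. \<forall>k. fps_nth F k \<in> R}"
  have eq: "supp2 S = {F. \<forall>k. fps_nth F k \<in> T}"
    by (auto simp: supp2_def T_def R_def coeff2_def)
  have R: "1 \<in> R" "\<forall>a\<in>R. \<forall>b\<in>R. a - b \<in> R \<and> a * b \<in> R"
  proof -
    show "1 \<in> R" using S by (simp add: R_def add_submonoid_def)
    have "a * b \<in> R" if "a \<in> R" "b \<in> R" for a b
      using that S unfolding R_def mem_Collect_eq
      by (intro keys_mult_subset[of a S b S]) (simp_all add: add_submonoid_def)
    then show "\<forall>a\<in>R. \<forall>b\<in>R. a - b \<in> R \<and> a * b \<in> R"
      by (simp add: R_def keys_diff_subset)
  qed
  note T = fps_coeffs_subring[OF R, folded T_def]
  have T': "\<forall>a\<in>T. \<forall>b\<in>T. a - b \<in> T \<and> a * b \<in> T"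
    using T(2,3) by blast
  note U = fps_coeffs_subring[OF T(1) T', folded eq]
  show "1 \<in> supp2 S" "\<And>F G. F \<in> supp2 S \<Longrightarrow> G \<in> supp2 S \<Longrightarrow> F * G \<in> supp2 S"
    by (rule U)+
  show "qvar \<in> supp2 S" "tvar \<in> supp2 S"
    unfolding qvar_def tvar_def by (intro U(5,6) T(5))+
  show "quot2 F G \<in> supp2 S" if "F \<in> supp2 S" "G \<in> supp2 S" for F G
    unfolding quot2_def
  proof (intro U(3,4) that T(4) R(1))
    show "fps_nth G 0 \<in> T" using that(2) by (simp add: eq)
  qed
  show "e_exp \<alpha> \<in> supp2 S" if "\<alpha> \<in> S" for \<alpha>
    unfolding e_exp_def const2_def by (intro U(6) T(6)) (use that in \<open>simp add: R_def\<close>)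
qed

lemma supp2_power: "add_submonoid S \<Longrightarrow> F \<in> supp2 S \<Longrightarrow> F ^ n \<in> supp2 S"
  by (induction n) (simp_all add: supp2_one supp2_times)

lemma supp2_prod:
  "add_submonoid S \<Longrightarrow> (\<And>i. i \<in> A \<Longrightarrow> f i \<in> supp2 S) \<Longrightarrow> prod f A \<in> supp2 S"
  by (induction A rule: infinite_finite_induct) (simp_all add: supp2_one supp2_times)

section \<open>The constant term map\<close>

lemma coeff2_CT: "coeff2 (CT F) i j = Poly_Mapping.lookup (coeff2 F i j) 0"
  by (simp add: CT_def coeff2_def)

lemma CT_add: "CT (F + G) = CT F + CT G"
  by (rule fps2_eqI) (simp add: coeff2_CT lookup_add)

lemma CT_diff: "CT (F - G) = CT F - CT G"
  by (rule fps2_eqI) (simp add: coeff2_CT lookup_minus)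

lemma CT_0: "CT 0 = 0"
  by (rule fps2_eqI, unfold coeff2_CT) (simp add: coeff2_def)

lemma CT_1: "CT 1 = 1"
  by (rule fps2_eqI, unfold coeff2_CT) (simp add: coeff2_def fps_one_nth lookup_one)

lemma CT_qvar: "CT qvar = qvar"
  by (rule fps2_eqI, unfold coeff2_CT) (simp add: coeff2_def qvar_def fps_X_nth lookup_one)

lemma CT_tvar: "CT tvar = tvar"
  by (rule fps2_eqI, unfold coeff2_CT) (simp add: coeff2_def tvar_def fps_X_nth fps_one_nth lookup_one)

lemma CT_sum: "CT (sum f A) = (\<Sum>i\<in>A. CT (f i))"
  by (induction A rule: infinite_finite_induct) (auto simp: CT_0 CT_add)

text \<open>In the convolution product the exponent 0 can arise only from the pair
  \<open>(0, 0)\<close>.\<close>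

lemma lookup_mult_0:
  fixes f g :: "weight \<Rightarrow>\<^sub>0 int"
  assumes "\<And>a b. a \<in> Poly_Mapping.keys f \<Longrightarrow> b \<in> Poly_Mapping.keys g \<Longrightarrow> a + b = 0 \<Longrightarrow> a = 0"
  shows "Poly_Mapping.lookup (f * g) 0 = Poly_Mapping.lookup f 0 * Poly_Mapping.lookup g 0"
proof -
  have "Poly_Mapping.lookup f a * (\<Sum>b. Poly_Mapping.lookup g b when 0 = a + b) =
      (Poly_Mapping.lookup f 0 * Poly_Mapping.lookup g 0 when a = 0)" for a
  proof (cases "a = 0 \<or> a \<notin> Poly_Mapping.keys f")
    case True
    then show ?thesis by (auto simp: in_keys_iff when_def)
  next
    case False
    then have "(Poly_Mapping.lookup g b when 0 = a + b) = 0" for b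
      using assms[of a b] by (auto simp: in_keys_iff when_def)
    then show ?thesis using False by simp
  qed
  then show ?thesis by (simp add: lookup_mult)
qed

lemma CT_mult:
  assumes F: "F \<in> supp2 S" and G: "G \<in> supp2 T"
    and ST: "\<And>a b. a \<in> S \<Longrightarrow> b \<in> T \<Longrightarrow> a + b = 0 \<Longrightarrow> a = 0"
  shows "CT (F * G) = CT F * CT G"
proof (rule fps2_eqI)
  fix i j
  have "Poly_Mapping.lookup (coeff2 F i' j' * coeff2 G i'' j'') 0 =
      Poly_Mapping.lookup (coeff2 F i' j') 0 * Poly_Mapping.lookup (coeff2 G i'' j'') 0" for i' j' i'' j''
  proof (rule lookup_mult_0)
    fix a b
    assume "a \<in> Poly_Mapping.keys (coeff2 F i' j')" "b \<in> Poly_Mapping.keys (coeff2 G i'' j'')" "a + b = 0"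
    moreover from this(1) have "a \<in> S"
      using F by (auto simp: supp2_def)
    moreover from calculation(2) have "b \<in> T"
      using G by (auto simp: supp2_def)
    ultimately show "a = 0" using ST by simp
  qed
  then show "coeff2 (CT (F * G)) i j = coeff2 (CT F * CT G) i j"
    by (simp add: coeff2_CT coeff2_mult lookup_sum)
qed

lemma CT_supp_0: "F \<in> supp2 S \<Longrightarrow> 0 \<notin> S \<Longrightarrow> CT F = 0"
proof (rule fps2_eqI)
  fix i j
  assume "F \<in> supp2 S" "0 \<notin> S"
  then have "0 \<notin> Poly_Mapping.keys (coeff2 F i j)" by (auto simp: supp2_def)
  then show "coeff2 (CT F) i j = coeff2 0 i j"
    by (simp add: coeff2_CT in_keys_iff) (simp add: coeff2_def)
qed

lemma submonoid_0: "add_submonoid {0}"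
  by (simp add: add_submonoid_def)

lemma CT_mult_const: "F \<in> supp2 {0} \<Longrightarrow> CT (F * G) = CT F * CT G"
  by (rule CT_mult[where T = UNIV]) (auto simp: supp2_def)

lemma CT_power_const: "F \<in> supp2 {0} \<Longrightarrow> CT (F ^ n) = CT F ^ n"
  by (induction n) (auto simp: CT_1 CT_mult_const)

section \<open>Weight factors and their degrees\<close>

definition root_vec :: "nat \<Rightarrow> nat \<Rightarrow> weight" where
  "root_vec i j = Poly_Mapping.single i 1 - Poly_Mapping.single j 1"

text \<open>The parameter \<open>a\<close> is \<open>qvar\<close>, or \<open>0\<close> for the Hall-Littlewood weight.\<close>

definition weight_factor :: "(weight \<Rightarrow>\<^sub>0 int) fps2 \<Rightarrow> nat \<Rightarrow> nat \<Rightarrow> (weight \<Rightarrow>\<^sub>0 int) fps2" where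
  "weight_factor a i j = quot2 ((1 - a * tvar * e_exp (root_vec i j)) * (1 - e_exp (root_vec i j)))
    ((1 - a * e_exp (root_vec i j)) * (1 - tvar * e_exp (root_vec i j)))"

lemma weight_factor_denom:
  assumes "coeff2 a 0 0 = 0"
  shows "coeff2 ((1 - a * e_exp \<alpha>) * (1 - tvar * e_exp \<alpha>)) 0 0 = 1"
  by (simp add: coeff2_00_mult assms)

lemma weight_factor_supp2:
  assumes "add_submonoid S" "a \<in> supp2 S" "root_vec i j \<in> S"
  shows "weight_factor a i j \<in> supp2 S"
  unfolding weight_factor_def
  by (intro supp2_quot2 supp2_times supp2_diff supp2_one supp2_tvar supp2_e_exp assms)

text \<open>An additive grading with value 0 at the exponent 0, so that a series supported in
  positive degrees has no constant term.\<close>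

definition degree_on :: "nat set \<Rightarrow> weight \<Rightarrow> int" where
  "degree_on A w = (\<Sum>i\<in>A. Poly_Mapping.lookup w i)"

lemma degree_on_add: "degree_on A (v + w) = degree_on A v + degree_on A w"
  by (simp add: degree_on_def lookup_add sum.distrib)

lemma degree_on_root:
  "finite A \<Longrightarrow> degree_on A (root_vec i j) = of_bool (i \<in> A) - of_bool (j \<in> A)"
  by (simp add: degree_on_def root_vec_def lookup_minus lookup_single sum_subtractf when_def)

text \<open>Numerator minus denominator of a weight factor; it is divisible by the exponential
  \<open>e\<close>.\<close>

lemma factor_diff:
  "(1 - a * t * e) * (1 - e) - (1 - a * e) * (1 - t * e) = e * ((a - 1) * (1 - t))"
  for a t e :: "'a::comm_ring_1"
  by (simp add: algebra_simps)

text \<open>By \<open>factor_diff\<close> the difference is the exponential of a root of degree 1 on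
  \<open>A\<close> times a series supported in degrees at least 0.\<close>

lemma weight_factor_minus_1:
  assumes a: "a \<in> supp2 {0}" "coeff2 a 0 0 = 0" and A: "finite A" "j \<in> A" "i \<notin> A"
  shows "weight_factor a j i - 1 \<in> supp2 {w. degree_on A w \<ge> 1}"
proof -
  let ?e = "e_exp (root_vec j i)"
  let ?N = "(1 - a * tvar * ?e) * (1 - ?e)" and ?D = "(1 - a * ?e) * (1 - tvar * ?e)"
  let ?S = "{w. degree_on A w \<ge> 0}"
  have deg: "degree_on A (root_vec j i) = 1" using A by (simp add: degree_on_root)
  have S: "add_submonoid ?S"
    by (auto simp: add_submonoid_def degree_on_add) (simp add: degree_on_def)
  have a': "a \<in> supp2 ?S" using a(1) by (rule supp2_mono) (simp add: degree_on_def)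
  have D: "coeff2 ?D 0 0 = 1" using a(2) by (rule weight_factor_denom)
  have "(weight_factor a j i - 1) * ?D = ?N - ?D"
    using quot2_mult_cancel[OF D, of ?N] by (simp add: weight_factor_def left_diff_distrib)
  also have "\<dots> = ?e * ((a - 1) * (1 - tvar))"
    by (rule factor_diff)
  finally have "weight_factor a j i - 1 = quot2 (?e * ((a - 1) * (1 - tvar))) ?D"
    by (rule quot2_eqI[OF D, symmetric])
  also have "\<dots> = ?e * quot2 ((a - 1) * (1 - tvar)) ?D"
    by (simp add: quot2_def mult.assoc)
  also have "\<dots> \<in> supp2 {w. degree_on A w \<ge> 1}"
  proof (rule supp2_mult)
    show "?e \<in> supp2 {root_vec j i}" by (auto simp: supp2_def coeff2_def e_exp_def const2_def)
    show "quot2 ((a - 1) * (1 - tvar)) ?D \<in> supp2 ?S"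
      by (intro supp2_quot2 supp2_times supp2_diff supp2_one supp2_tvar supp2_e_exp S a') (simp_all add: deg)
  qed (auto simp: degree_on_add deg)
  finally show ?thesis .
qed

text \<open>Induction with \<open>f g - 1 = (f - 1)(g - 1) + (f - 1) + (g - 1)\<close>; closure of
  \<open>P\<close> under addition takes care of the first term.\<close>

lemma prod_minus_1_supp2:
  assumes P: "\<And>a b. a \<in> P \<Longrightarrow> b \<in> P \<Longrightarrow> a + b \<in> P"
    and f: "\<And>i. i \<in> A \<Longrightarrow> f i - 1 \<in> supp2 P"
  shows "prod f A - 1 \<in> supp2 P"
  using f
proof (induction A rule: infinite_finite_induct)
  case (insert x A)
  let ?g = "prod f A"
  have x: "f x - 1 \<in> supp2 P" and g: "?g - 1 \<in> supp2 P"
    by (rule insert.prems, simp, rule insert.IH, rule insert.prems, simp)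
  have eq: "f x * ?g - 1 = (f x - 1) * (?g - 1) + (f x - 1) + (?g - 1)"
    by (simp add: left_diff_distrib right_diff_distrib)
  have "(f x - 1) * (?g - 1) \<in> supp2 P"
    by (rule supp2_mult[OF x g P])
  then show ?case
    unfolding prod.insert[OF insert.hyps] eq by (intro supp2_add x g)
qed (simp_all add: supp2_def coeff2_def)

text \<open>\<open>F * G\<close> has degree 0 on \<open>A\<close>, so \<open>H - 1\<close>
  contributes only exponents of positive degree. As \<open>F\<close> and \<open>G\<close> involve
  disjoint sets of variables, their exponents cancel only if both are 0.\<close>

lemma CT_factor:
  assumes B: "finite B" and A: "finite A" and disj: "A \<inter> B = {}"
    and F: "F \<in> supp2 {w. Poly_Mapping.keys w \<subseteq> B}"
    and G: "G \<in> supp2 {w. Poly_Mapping.keys w \<subseteq> A \<and> degree_on A w = 0}"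
    and H: "H - 1 \<in> supp2 {w. degree_on A w \<ge> 1}"
  shows "CT (F * G * H) = CT F * CT G"
proof -
  have "F * G * (H - 1) \<in> supp2 {w. degree_on A w \<ge> 1}"
  proof (intro supp2_mult[OF _ H] supp2_mult[OF F G])
    fix a b :: weight assume a: "a \<in> {w. Poly_Mapping.keys w \<subseteq> B}"
      and b: "b \<in> {w. Poly_Mapping.keys w \<subseteq> A \<and> degree_on A w = 0}"
    have "degree_on A a = 0"
      unfolding degree_on_def using a disj by (intro sum.neutral) (auto simp: in_keys_iff)
    then show "a + b \<in> {w. degree_on A w = 0}" using b by (simp add: degree_on_add)
  qed (auto simp: degree_on_add)
  then have "CT (F * G * (H - 1)) = 0"
    by (rule CT_supp_0) (simp add: degree_on_def)
  moreover have "F * G * H = F * G + F * G * (H - 1)"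
    by (simp add: algebra_simps)
  moreover have "CT (F * G) = CT F * CT G"
  proof (rule CT_mult[OF F G])
    fix a b :: weight
    assume "a \<in> {w. Poly_Mapping.keys w \<subseteq> B}"
      "b \<in> {w. Poly_Mapping.keys w \<subseteq> A \<and> degree_on A w = 0}" and ab: "a + b = 0"
    then have "Poly_Mapping.keys a \<subseteq> B" "Poly_Mapping.keys b \<subseteq> A" by auto
    moreover have "Poly_Mapping.lookup a k + Poly_Mapping.lookup b k = 0" for k
      using ab by (metis lookup_add lookup_zero)
    then have "Poly_Mapping.keys b = Poly_Mapping.keys a"
      by (auto simp: in_keys_iff) (metis add.right_neutral add.left_neutral)+
    ultimately have "Poly_Mapping.keys a \<subseteq> A \<inter> B" by simp
    then show "a = 0" using disj by simp
  qed
  ultimately show ?thesis by (simp add: CT_add)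
qed

section \<open>Sums over the symmetric group\<close>

text \<open>With a separate variable attached to every point, a point can be removed from a cycle by
  multiplying its variable into that of its image.  Keeping track of these variables makes an
  induction on \<open>n\<close> possible without decomposing permutations into cycles.\<close>

definition cyc_det :: "nat \<Rightarrow> (nat \<Rightarrow> nat) \<Rightarrow> (nat \<Rightarrow> 'a) \<Rightarrow> 'a::idom" where
  "cyc_det n w z = det (mat n n (\<lambda>(i, j). of_bool (i = j) - z j * of_bool (j = w i)))"

lemma cyc_det_cong: "(\<And>i. i < n \<Longrightarrow> z i = z' i) \<Longrightarrow> cyc_det n w z = cyc_det n w z'"
  unfolding cyc_det_def by (rule arg_cong[where f = det]) (rule eq_matI, simp_all)

lemma det_last_row:
  fixes A :: "'a::comm_ring_1 mat"
  assumes A: "A \<in> carrier_mat (Suc m) (Suc m)" and z: "\<And>j. j < m \<Longrightarrow> A $$ (m, j) = 0"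
  shows "det A = A $$ (m, m) * det (mat m m (\<lambda>(i, j). A $$ (i, j)))"
proof -
  have "det A = (\<Sum>j<Suc m. A $$ (m, j) * cofactor A m j)"
    by (rule laplace_expansion_row[OF A]) simp
  also have "\<dots> = A $$ (m, m) * cofactor A m m"
    using z by simp
  also have "mat_delete A m m = mat m m (\<lambda>(i, j). A $$ (i, j))"
    using A by (intro eq_matI) (simp_all add: mat_delete_def)
  then have "cofactor A m m = det (mat m m (\<lambda>(i, j). A $$ (i, j)))"
    by (simp add: cofactor_def flip: mult_2)
  finally show ?thesis .
qed

lemma det_last_column:
  fixes A :: "'a::comm_ring_1 mat"
  assumes A: "A \<in> carrier_mat (Suc m) (Suc m)" and z: "\<And>i. i < m \<Longrightarrow> A $$ (i, m) = 0"
  shows "det A = A $$ (m, m) * det (mat m m (\<lambda>(i, j). A $$ (i, j)))"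
proof -
  have "det A = (\<Sum>i<Suc m. A $$ (i, m) * cofactor A i m)"
    by (rule laplace_expansion_column[OF A]) simp
  also have "\<dots> = A $$ (m, m) * cofactor A m m"
    using z by simp
  also have "mat_delete A m m = mat m m (\<lambda>(i, j). A $$ (i, j))"
    using A by (intro eq_matI) (simp_all add: mat_delete_def)
  then have "cofactor A m m = det (mat m m (\<lambda>(i, j). A $$ (i, j)))"
    by (simp add: cofactor_def flip: mult_2)
  finally show ?thesis .
qed

lemma permutes_lessThan_less: "p permutes {..<n} \<Longrightarrow> i < n \<Longrightarrow> p i < n" for i n :: nat
  using permutes_in_image[of p "{..<n}" i] by simp

lemma cyc_det_fixed:
  assumes p: "p permutes {..<m}"
  shows "cyc_det (Suc m) p z = (1 - z m) * cyc_det m p z"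
proof -
  let ?A = "mat (Suc m) (Suc m) (\<lambda>(i, j). of_bool (i = j) - z j * of_bool (j = p i))"
  have "p m = m" using p by (auto intro: permutes_not_in)
  then have "det ?A = ?A $$ (m, m) * det (mat m m (\<lambda>(i, j). ?A $$ (i, j)))"
    by (intro det_last_row) auto
  also have "mat m m (\<lambda>(i, j). ?A $$ (i, j)) = mat m m (\<lambda>(i, j). of_bool (i = j) - z j * of_bool (j = p i))"
    by (rule eq_matI) simp_all
  finally show ?thesis using \<open>p m = m\<close> by (simp add: cyc_det_def)
qed

text \<open>Composition with the transposition inserts \<open>m\<close> just before \<open>b\<close>
  in a cycle of \<open>p\<close>. With \<open>c\<close> the preimage of \<open>b\<close>, adding
  \<open>z m\<close> times row \<open>m\<close> to row \<open>c\<close> clears the last column above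
  the diagonal and contributes \<open>- z b * z m\<close> to the entry at
  \<open>(c, b)\<close>.\<close>

lemma cyc_det_insert:
  assumes p: "p permutes {..<m}" and b: "b < m"
  shows "cyc_det (Suc m) (transpose m b \<circ> p) z = cyc_det m p (z(b := z b * z m))"
proof -
  let ?w = "transpose m b \<circ> p"
  let ?A = "mat (Suc m) (Suc m) (\<lambda>(i, j). of_bool (i = j) - z j * of_bool (j = ?w i))"
  obtain c where c: "p c = b" using permutes_surj[OF p] by (metis surjD)
  have pm: "p m = m" using p by (auto intro: permutes_not_in)
  have cm: "c < m"
    using c b permutes_not_in[OF p, of c] by (cases "c < m") auto
  have pb: "p i = b \<longleftrightarrow> i = c" for i
    using c permutes_inj[OF p] by (auto dest: injD)
  have plt: "p i < m" if "i < m" for i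
    using permutes_lessThan_less[OF p that] .
  let ?B = "addrow (z m) c m ?A"
  have "det ?B = det ?A"
    by (rule det_addrow[of _ "Suc m"]) (use cm in auto)
  moreover have "det ?B = ?B $$ (m, m) * det (mat m m (\<lambda>(i, j). ?B $$ (i, j)))"
  proof (rule det_last_column)
    fix i assume i: "i < m"
    show "?B $$ (i, m) = 0"
      using i cm b pm plt[OF i] c pb[of i] by (auto simp: transpose_def)
  qed simp
  moreover have "?B $$ (m, m) = 1"
    using cm b pm by (simp add: transpose_def)
  moreover have "mat m m (\<lambda>(i, j). ?B $$ (i, j)) =
      mat m m (\<lambda>(i, j). of_bool (i = j) - (z(b := z b * z m)) j * of_bool (j = p i))"
  proof (rule eq_matI)
    fix i j assume "i < dim_row (mat m m (\<lambda>(i, j). of_bool (i = j) - (z(b := z b * z m)) j * of_bool (j = p i)))"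
      "j < dim_col (mat m m (\<lambda>(i, j). of_bool (i = j) - (z(b := z b * z m)) j * of_bool (j = p i)))"
    then have ij: "i < m" "j < m" by simp_all
    show "mat m m (\<lambda>(i, j). ?B $$ (i, j)) $$ (i, j) =
      mat m m (\<lambda>(i, j). of_bool (i = j) - (z(b := z b * z m)) j * of_bool (j = p i)) $$ (i, j)"
      using ij cm b pm plt[of i] c pb[of i] by (auto simp: transpose_def)
  qed simp_all
  ultimately show ?thesis by (simp add: cyc_det_def)
qed

text \<open>Rows and columns are permuted alike, so the sign of the permutation occurs
  twice.\<close>

lemma det_conjugate:
  fixes f :: "nat \<Rightarrow> nat \<Rightarrow> 'a::comm_ring_1"
  assumes \<tau>: "\<tau> permutes {..<n}"
  shows "det (mat n n (\<lambda>(i, j). f (\<tau> i) (\<tau> j))) = det (mat n n (\<lambda>(i, j). f i j))"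
proof -
  have \<tau>': "\<tau> permutes {0..<n}" using \<tau> by (simp add: atLeast0LessThan)
  have lt: "\<tau> i < n" if "i < n" for i using permutes_lessThan_less[OF \<tau> that] .
  let ?F = "mat n n (\<lambda>(i, j). f i j)" and ?C = "mat n n (\<lambda>(i, j). f i (\<tau> j))"
  have "mat n n (\<lambda>(i, j). f (\<tau> i) (\<tau> j)) = mat n n (\<lambda>(i, j). ?C $$ (\<tau> i, j))"
    by (rule eq_matI) (simp_all add: lt)
  then have 1: "det (mat n n (\<lambda>(i, j). f (\<tau> i) (\<tau> j))) = signof \<tau> * det ?C"
    using det_permute_rows[of ?C n \<tau>] \<tau>' by simp
  have "?C\<^sup>T = mat n n (\<lambda>(i, j). ?F\<^sup>T $$ (\<tau> i, j))"
    by (rule eq_matI) (simp_all add: lt)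
  then have "det (?C\<^sup>T) = signof \<tau> * det (?F\<^sup>T)"
    using det_permute_rows[of "?F\<^sup>T" n \<tau>] \<tau>' by simp
  then have 2: "det ?C = signof \<tau> * det ?F"
    by (simp add: det_transpose[of _ n])
  have "(signof \<tau> :: 'a) * signof \<tau> = 1"
    by (simp add: sign_def)
  then show ?thesis unfolding 1 2 by (simp flip: mult.assoc)
qed

lemma cyc_det_conjugate:
  assumes "\<tau> permutes {..<n}"
  shows "cyc_det n (\<tau> \<circ> p \<circ> Hilbert_Choice.inv \<tau>) z = cyc_det n p (z \<circ> \<tau>)"
proof -
  have "cyc_det n (\<tau> \<circ> p \<circ> Hilbert_Choice.inv \<tau>) z = det (mat n n (\<lambda>(i, j).
      of_bool (\<tau> i = \<tau> j) - z (\<tau> j) * of_bool (\<tau> j = \<tau> (p (Hilbert_Choice.inv \<tau> (\<tau> i))))))"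
    unfolding cyc_det_def using det_conjugate[OF assms,
      of "\<lambda>i j. of_bool (i = j) - z j * of_bool (j = \<tau> (p (Hilbert_Choice.inv \<tau> i)))"] by simp
  also have "\<dots> = cyc_det n p (z \<circ> \<tau>)"
    unfolding cyc_det_def using permutes_inj[OF assms]
    by (simp add: inj_eq)
  finally show ?thesis .
qed

text \<open>All variables are powers of \<open>q * t\<close>, \<open>q\<close> or \<open>t\<close>,
  so merging two points adds their exponents \<open>k\<close>.\<close>

definition cyc_ratio :: "'a::field \<Rightarrow> 'a \<Rightarrow> nat \<Rightarrow> (nat \<Rightarrow> nat) \<Rightarrow> (nat \<Rightarrow> nat) \<Rightarrow> 'a" where
  "cyc_ratio q t n w k = cyc_det n w (\<lambda>i. (q * t) ^ k i) /
     (cyc_det n w (\<lambda>i. q ^ k i) * cyc_det n w (\<lambda>i. t ^ k i))"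

definition cyc_sum :: "'a::field \<Rightarrow> 'a \<Rightarrow> nat \<Rightarrow> (nat \<Rightarrow> nat) \<Rightarrow> 'a" where
  "cyc_sum q t n k = (\<Sum>w | w permutes {..<n}. cyc_ratio q t n w k)"

text \<open>The contribution of a cycle whose exponents add up to \<open>k\<close>.\<close>

definition cyc_weight :: "'a::field \<Rightarrow> 'a \<Rightarrow> nat \<Rightarrow> 'a" where
  "cyc_weight q t k = (1 - (q * t) ^ k) / ((1 - q ^ k) * (1 - t ^ k))"

lemma cyc_ratio_cong: "(\<And>i. i < n \<Longrightarrow> k i = k' i) \<Longrightarrow> cyc_ratio q t n w k = cyc_ratio q t n w k'"
  unfolding cyc_ratio_def using cyc_det_cong[of n _ _ w]
  by (intro arg_cong2[of _ _ _ _ "(/)"] arg_cong2[of _ _ _ _ "(*)"] cyc_det_cong) simp_all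

lemma cyc_sum_cong: "(\<And>i. i < n \<Longrightarrow> k i = k' i) \<Longrightarrow> cyc_sum q t n k = cyc_sum q t n k'"
  unfolding cyc_sum_def by (intro sum.cong refl cyc_ratio_cong)

lemma cyc_ratio_fixed:
  "p permutes {..<m} \<Longrightarrow> cyc_ratio q t (Suc m) p k = cyc_weight q t (k m) * cyc_ratio q t m p k"
  by (simp add: cyc_ratio_def cyc_weight_def cyc_det_fixed)

lemma cyc_ratio_insert:
  assumes "p permutes {..<m}" "b < m"
  shows "cyc_ratio q t (Suc m) (transpose m b \<circ> p) k = cyc_ratio q t m p (k(b := k b + k m))"
proof -
  have "cyc_det (Suc m) (transpose m b \<circ> p) (\<lambda>i. r ^ k i) = cyc_det m p (\<lambda>i. r ^ (k(b := k b + k m)) i)"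
    for r :: 'a
  proof -
    have "(\<lambda>i. r ^ k i)(b := r ^ k b * r ^ k m) = (\<lambda>i. r ^ (k(b := k b + k m)) i)"
      by (auto simp: fun_eq_iff power_add)
    then show ?thesis by (simp only: cyc_det_insert[OF assms])
  qed
  then show ?thesis by (simp only: cyc_ratio_def)
qed

text \<open>Conjugation by \<open>\<tau>\<close> permutes the summands: it matters which exponents
  occur, not where.\<close>

lemma cyc_sum_permute:
  assumes \<tau>: "\<tau> permutes {..<n}"
  shows "cyc_sum q t n (k \<circ> \<tau>) = cyc_sum q t n k"
proof -
  let ?i = "Hilbert_Choice.inv \<tau>"
  have i: "?i permutes {..<n}" using \<tau> by (rule permutes_inv)
  have c: "\<tau> \<circ> ?i = id" "?i \<circ> \<tau> = id" using permutes_inv_o[OF \<tau>] by auto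
  have "cyc_ratio q t n p (k \<circ> \<tau>) = cyc_ratio q t n (\<tau> \<circ> p \<circ> ?i) k" for p
    unfolding cyc_ratio_def cyc_det_conjugate[OF \<tau>] by (simp add: o_def)
  then have "cyc_sum q t n (k \<circ> \<tau>) = (\<Sum>p | p permutes {..<n}. cyc_ratio q t n (\<tau> \<circ> p \<circ> ?i) k)"
    by (simp add: cyc_sum_def)
  also have "\<dots> = cyc_sum q t n k"
    unfolding cyc_sum_def
  proof (rule sum.reindex_bij_witness[where i = "\<lambda>p. ?i \<circ> p \<circ> \<tau>" and j = "\<lambda>p. \<tau> \<circ> p \<circ> ?i"])
    fix p assume "p \<in> {w. w permutes {..<n}}"
    then have p: "p permutes {..<n}" by simp
    show "\<tau> \<circ> p \<circ> ?i \<in> {w. w permutes {..<n}}" "?i \<circ> p \<circ> \<tau> \<in> {w. w permutes {..<n}}"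
      using p \<tau> i by (auto intro!: permutes_compose)
    show "?i \<circ> (\<tau> \<circ> p \<circ> ?i) \<circ> \<tau> = p" "\<tau> \<circ> (?i \<circ> p \<circ> \<tau>) \<circ> ?i = p"
      using permutes_inverses[OF \<tau>] by (simp_all add: fun_eq_iff)
  qed simp
  finally show ?thesis .
qed

text \<open>The exponent \<open>e\<close> records how many points have been merged into the point
  \<open>m\<close>, itself included.\<close>

definition marked :: "nat \<Rightarrow> nat \<Rightarrow> nat \<Rightarrow> nat" where
  "marked m e i = (if i = m then e else 1)"

lemma marked_1: "marked m 1 = (\<lambda>_. 1)"
  by (simp add: marked_def fun_eq_iff)

text \<open>A permutation of \<open>Suc m\<close> points is \<open>transpose m b \<circ> p\<close>
  with \<open>p\<close> fixing \<open>m\<close>. For \<open>b = m\<close> the marked point is a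
  closed cycle of weight \<open>e\<close>; for each of the \<open>m\<close> other values it is
  merged into \<open>b\<close>, which takes over the mark as \<open>Suc e\<close>.\<close>

lemma cyc_sum_step:
  "cyc_sum q t (Suc m) (marked m e) =
    cyc_weight q t e * cyc_sum q t m (\<lambda>_. 1) + of_nat m * cyc_sum q t m (marked (m - 1) (Suc e))"
proof -
  let ?k = "marked m e"
  have "cyc_sum q t (Suc m) ?k = (\<Sum>w | w permutes insert m {..<m}. cyc_ratio q t (Suc m) w ?k)"
    by (simp add: cyc_sum_def lessThan_Suc)
  also have "\<dots> = (\<Sum>b\<in>insert m {..<m}. \<Sum>p | p permutes {..<m}. cyc_ratio q t (Suc m) (transpose m b \<circ> p) ?k)"
    by (rule sum_over_permutations_insert) simp_all
  also have "\<dots> = (\<Sum>p | p permutes {..<m}. cyc_ratio q t (Suc m) p ?k) +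
      (\<Sum>b<m. \<Sum>p | p permutes {..<m}. cyc_ratio q t (Suc m) (transpose m b \<circ> p) ?k)"
    by simp
  also have "(\<Sum>p | p permutes {..<m}. cyc_ratio q t (Suc m) p ?k) =
      (\<Sum>p | p permutes {..<m}. cyc_weight q t e * cyc_ratio q t m p ?k)"
    by (rule sum.cong) (simp_all add: cyc_ratio_fixed marked_def)
  also have "\<dots> = cyc_weight q t e * cyc_sum q t m ?k"
    by (simp add: cyc_sum_def sum_distrib_left)
  also have "cyc_sum q t m ?k = cyc_sum q t m (\<lambda>_. 1)"
    by (rule cyc_sum_cong) (simp add: marked_def)
  also have "(\<Sum>b<m. \<Sum>p | p permutes {..<m}. cyc_ratio q t (Suc m) (transpose m b \<circ> p) ?k) =
      (\<Sum>b<m. cyc_sum q t m (marked (m - 1) (Suc e)))"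
  proof (rule sum.cong[OF refl])
    fix b assume "b \<in> {..<m}"
    then have b: "b < m" by simp
    have "(\<Sum>p | p permutes {..<m}. cyc_ratio q t (Suc m) (transpose m b \<circ> p) ?k) =
        cyc_sum q t m (?k(b := ?k b + ?k m))"
      unfolding cyc_sum_def using b by (intro sum.cong refl cyc_ratio_insert) simp_all
    \<comment> \<open>A transposition carries the new mark from \<open>b\<close> to
      \<open>m - 1\<close>, so that all \<open>b\<close> give the same sum.\<close>
    also have "\<dots> = cyc_sum q t m ((marked (m - 1) (Suc e)) \<circ> transpose b (m - 1))"
      by (rule cyc_sum_cong) (use b in \<open>auto simp: transpose_def marked_def\<close>)
    also have "\<dots> = cyc_sum q t m (marked (m - 1) (Suc e))"
      by (rule cyc_sum_permute) (use b in \<open>auto intro: permutes_swap_id\<close>)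
    finally show "(\<Sum>p | p permutes {..<m}. cyc_ratio q t (Suc m) (transpose m b \<circ> p) ?k) =
        cyc_sum q t m (marked (m - 1) (Suc e))" .
  qed
  finally show ?thesis by simp
qed

text \<open>Iteration of \<open>cyc_sum_step\<close>: \<open>j\<close> counts the mergers before the
  marked cycle closes, leaving \<open>m - j\<close> free points. Their factor
  \<open>fact (m - j)\<close> and the choices of the merged points multiply to
  \<open>fact m\<close>.\<close>

lemma cyc_sum_marked:
  fixes q t :: "'a::field"
  assumes "\<And>i. i \<le> m \<Longrightarrow> cyc_sum q t i (\<lambda>_. 1) = of_nat (fact i) * h i"
  shows "cyc_sum q t (Suc m) (marked m e) = of_nat (fact m) * (\<Sum>j\<le>m. cyc_weight q t (e + j) * h (m - j))"
  using assms
proof (induction m arbitrary: e)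
  case 0
  then show ?case using cyc_sum_step[of q t 0 e] by simp
next
  case (Suc m)
  have IH: "cyc_sum q t (Suc m) (marked m (Suc e)) =
      of_nat (fact m) * (\<Sum>j\<le>m. cyc_weight q t (Suc e + j) * h (m - j))"
    by (rule Suc.IH, rule Suc.prems, simp)
  have f: "of_nat (Suc m) * of_nat (fact m) = (of_nat (fact (Suc m)) :: 'a)"
    by (simp only: of_nat_mult[symmetric] fact_Suc of_nat_id)
  have "cyc_sum q t (Suc (Suc m)) (marked (Suc m) e) =
      cyc_weight q t e * (of_nat (fact (Suc m)) * h (Suc m)) + of_nat (Suc m) *
        (of_nat (fact m) * (\<Sum>j\<le>m. cyc_weight q t (Suc e + j) * h (m - j)))"
    unfolding cyc_sum_step[of q t "Suc m" e] diff_Suc_1 IH Suc.prems[OF order_refl] by (rule refl)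
  also have "\<dots> = of_nat (fact (Suc m)) * (cyc_weight q t e * h (Suc m) +
      (\<Sum>j\<le>m. cyc_weight q t (e + Suc j) * h (Suc m - Suc j)))"
    unfolding mult.assoc[symmetric] f by (simp add: distrib_left mult.assoc mult.left_commute del: of_nat_fact fact_Suc)
  also have "cyc_weight q t e * h (Suc m) + (\<Sum>j\<le>m. cyc_weight q t (e + Suc j) * h (Suc m - Suc j)) =
      (\<Sum>j\<le>Suc m. cyc_weight q t (e + j) * h (Suc m - j))"
    by (subst sum.atMost_Suc_shift) simp
  finally show ?case .
qed

text \<open>With all exponents 1 the sum is the marked one for \<open>e = 1\<close>;
  \<open>cyc_sum_marked\<close> produces the right side of Newton's identities, whose factor
  \<open>n\<close> completes \<open>fact (n - 1)\<close> to \<open>fact n\<close>.\<close>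

lemma cyc_sum_eq:
  fixes q t :: "'a::field"
  assumes q: "\<And>k. k > 0 \<Longrightarrow> q ^ k \<noteq> 1" and t: "\<And>k. k > 0 \<Longrightarrow> t ^ k \<noteq> 1"
  shows "cyc_sum q t n (\<lambda>_. 1) = of_nat (fact n) * fps_nth (hseries q t) n"
proof (induction n rule: less_induct)
  case (less n)
  show ?case
  proof (cases n)
    case 0
    then show ?thesis by (simp add: cyc_sum_def cyc_ratio_def cyc_det_def hseries_0[OF q t])
  next
    case (Suc m)
    have "cyc_sum q t n (\<lambda>_. 1) = cyc_sum q t (Suc m) (marked m 1)"
      by (simp only: Suc marked_1)
    also have "\<dots> = of_nat (fact m) * (\<Sum>j\<le>m. cyc_weight q t (1 + j) * fps_nth (hseries q t) (m - j))"
      by (rule cyc_sum_marked, rule less.IH, simp add: Suc)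
    also have "(\<Sum>j\<le>m. cyc_weight q t (1 + j) * fps_nth (hseries q t) (m - j)) =
        (\<Sum>k=1..n. cyc_weight q t k * fps_nth (hseries q t) (n - k))"
      by (rule sum.reindex_bij_witness[where i = "\<lambda>k. k - 1" and j = Suc]) (auto simp: Suc)
    also have "\<dots> = of_nat n * fps_nth (hseries q t) n"
      unfolding cyc_weight_def power_mult_distrib by (rule hseries_newton[OF q t, symmetric])
    also have "of_nat (fact m) * (of_nat n * fps_nth (hseries q t) n) = of_nat (fact n) * fps_nth (hseries q t) n"
      unfolding Suc by (simp only: fact_Suc of_nat_mult of_nat_id ac_simps)
    finally show ?thesis .
  qed
qed

text \<open>The columns of \<open>?U\<close> below are the simple coroots and the last standard basis vector, on which
  \<open>w\<close> acts trivially modulo the coroots.\<close>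

lemma refl_det_cyc_det:
  assumes w: "w \<in> weyl_group n" and n: "n \<ge> 1"
  shows "(1 - z) * refl_det n z w = cyc_det n w (\<lambda>_. z)"
proof -
  obtain m where m: "n = Suc m" using n by (cases n) auto
  have p: "w permutes {..<n}" using w by (simp add: weyl_group_def)
  have lt: "w i < n" if "i < n" for i using permutes_lessThan_less[OF p that] .
  \<comment> \<open>Coordinates with respect to the columns of \<open>?U\<close> are partial sums of
    entries, which gives the indicators \<open>w i \<le> k\<close>. In row \<open>m\<close> they are
    0 except for a final 1, so the last row of \<open>?Q\<close> is zero apart from
    \<open>1 - z\<close>.\<close>
  let ?M = "\<lambda>k i. if i < m then of_bool (w i \<le> k) - of_bool (w (Suc i) \<le> k) else of_bool (w i \<le> k) :: int fps2"
  let ?U = "mat n n (\<lambda>(k, j). of_bool (k = j) - of_bool (k = Suc j)) :: int fps2 mat"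
  let ?P = "mat n n (\<lambda>(k, j). of_bool (k = j) - z * of_bool (w j = k))"
  let ?Q = "mat n n (\<lambda>(k, j). of_bool (k = j) - z * ?M k j)"
  have "?P * ?U = ?U * ?Q"
  proof (rule eq_matI)
    fix k i assume "k < dim_row (?U * ?Q)" "i < dim_col (?U * ?Q)"
    then have ki: "k < n" "i < n" by simp_all
    have "(?P * ?U) $$ (k, i) = (\<Sum>j<n. (of_bool (k = j) - z * of_bool (w j = k)) * (of_bool (j = i) - of_bool (j = Suc i)))"
      using ki by (simp add: scalar_prod_def atLeast0LessThan)
    also have "\<dots> = (\<Sum>j<n. if j = i then of_bool (k = j) - z * of_bool (w j = k) else 0) -
        (\<Sum>j<n. if j = Suc i then of_bool (k = j) - z * of_bool (w j = k) else 0)"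
      unfolding sum_subtractf[symmetric] by (rule sum.cong) auto
    also have "\<dots> = (of_bool (k = i) - z * of_bool (w i = k)) -
        (if Suc i < n then of_bool (k = Suc i) - z * of_bool (w (Suc i) = k) else 0)"
      using ki by simp
    also have "\<dots> = (of_bool (k = i) - z * ?M k i) -
        (if 0 < k then of_bool (k - 1 = i) - z * ?M (k - 1) i else 0)"
    proof -
      have "of_bool (w j = k) = (of_bool (w j \<le> k) - (if 0 < k then of_bool (w j \<le> k - 1) else 0) :: int fps2)" for j
        by (cases k) (auto simp: le_Suc_eq)
      moreover have "k = Suc i \<longleftrightarrow> 0 < k \<and> k - 1 = i" by auto
      ultimately show ?thesis using ki by (auto simp: m algebra_simps)
    qed
    also have "\<dots> = (\<Sum>j<n. if j = k then of_bool (j = i) - z * ?M j i else 0) -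
        (\<Sum>j<n. if k = Suc j then of_bool (j = i) - z * ?M j i else 0)"
    proof -
      have "(\<Sum>j<n. if k = Suc j then of_bool (j = i) - z * ?M j i else 0) =
          (if 0 < k then of_bool (k - 1 = i) - z * ?M (k - 1) i else 0)"
        using ki by (cases k) simp_all
      then show ?thesis using ki by simp
    qed
    also have "\<dots> = (\<Sum>j<n. (of_bool (k = j) - of_bool (k = Suc j)) * (of_bool (j = i) - z * ?M j i))"
      unfolding sum_subtractf[symmetric] by (rule sum.cong) auto
    also have "\<dots> = (?U * ?Q) $$ (k, i)"
      using ki by (simp add: scalar_prod_def atLeast0LessThan)
    finally show "(?P * ?U) $$ (k, i) = (?U * ?Q) $$ (k, i)" .
  qed simp_all
  moreover have "det (?P * ?U) = det ?P * det ?U" "det (?U * ?Q) = det ?U * det ?Q"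
    by (rule det_mult[of _ n]; simp)+
  moreover have "det ?U = 1"
  proof -
    have "det ?U = det (?U\<^sup>T)" by (rule det_transpose[symmetric, of _ n]) simp
    also have "\<dots> = prod_list (diag_mat (?U\<^sup>T))"
      by (rule det_upper_triangular[of _ n]) auto
    also have "\<dots> = 1"
      by (simp add: prod_list_diag_prod)
    finally show ?thesis .
  qed
  ultimately have PQ: "det ?P = det ?Q" by simp
  have "det ?P = det (?P\<^sup>T)" by (rule det_transpose[symmetric, of _ n]) simp
  also have "?P\<^sup>T = mat n n (\<lambda>(i, j). of_bool (i = j) - z * of_bool (j = w i))"
    by (rule eq_matI) auto
  also have "det \<dots> = cyc_det n w (\<lambda>_. z)"
    by (simp add: cyc_det_def)
  finally have P: "det ?P = cyc_det n w (\<lambda>_. z)" .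
  have wm: "w j \<le> m" if "j \<le> m" for j using lt[of j] that by (simp add: m)
  have "det ?Q = ?Q $$ (m, m) * det (mat m m (\<lambda>(i, j). ?Q $$ (i, j)))"
    by (rule det_last_row) (auto simp: m wm)
  also have "?Q $$ (m, m) = 1 - z" by (simp add: m wm)
  also have "mat m m (\<lambda>(i, j). ?Q $$ (i, j)) =
      1\<^sub>m (n - 1) - z \<cdot>\<^sub>m map_mat const2 (refl_mat n w)"
  proof -
    have R: "refl_mat n w = mat m m (\<lambda>(j, i). of_bool (w i \<le> j) - of_bool (w (Suc i) \<le> j))"
      unfolding refl_mat_eq[OF w] by (simp add: m)
    have "const2 (of_bool a - of_bool b) = (of_bool a - of_bool b :: int fps2)" for a b
      by (auto simp: const2_def fps_const_neg[symmetric] simp del: fps_const_neg)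
    then show ?thesis
      unfolding R by (intro eq_matI) (auto simp: m)
  qed
  finally show ?thesis using PQ P by (simp add: refl_det_def)
qed

section \<open>The constant terms\<close>

interpretation to_fract_hom: comm_ring_hom to_fract
  by unfold_locales simp_all

lemma e_exp_add: "e_exp (\<alpha> + \<beta>) = e_exp \<alpha> * e_exp \<beta>"
  by (simp add: e_exp_def const2_def mult_single)

text \<open>The variables \<open>x\<^sub>i\<close>. Their exponents lie in the ambient lattice; the
  exponential of a root is a quotient of two of them in the fraction field.\<close>

definition e_eps :: "nat \<Rightarrow> (weight \<Rightarrow>\<^sub>0 int) fps2" where
  "e_eps i = e_exp (Poly_Mapping.single i 1)"

lemma coeff2_e_eps: "coeff2 (e_eps i) 0 0 = Poly_Mapping.single (Poly_Mapping.single i 1) 1"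
  by (simp add: e_eps_def e_exp_def const2_def coeff2_def)

text \<open>The coefficient at \<open>q^0 t^0\<close> is the monomial of \<open>e_eps k\<close>.
  Applied with \<open>c\<close> equal to \<open>a\<close>, \<open>tvar\<close> and
  \<open>a * tvar\<close>, this shows that the denominators do not vanish.\<close>

lemma e_eps_diff_nonzero:
  assumes "coeff2 c 0 0 = 0"
  shows "e_eps k - c * e_eps i \<noteq> 0"
proof
  assume "e_eps k - c * e_eps i = 0"
  then have "coeff2 (e_eps k - c * e_eps i) 0 0 = 0" by simp
  then have "coeff2 (e_eps k) 0 0 = 0"
    by (simp only: coeff2_diff coeff2_00_mult assms mult_zero_left diff_zero)
  then show False by (simp add: coeff2_e_eps)
qed

lemma e_eps_nonzero: "e_eps k \<noteq> 0"
  using e_eps_diff_nonzero[of 0 k k] by simp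

lemma e_eps_inj: "e_eps i = e_eps j \<Longrightarrow> i = j"
proof -
  assume "e_eps i = e_eps j"
  then have "Poly_Mapping.single (Poly_Mapping.single i (1::int)) (1::int) =
      Poly_Mapping.single (Poly_Mapping.single j 1) 1"
    using coeff2_e_eps by metis
  then have "Poly_Mapping.keys (Poly_Mapping.single (Poly_Mapping.single i (1::int)) (1::int)) =
      Poly_Mapping.keys (Poly_Mapping.single (Poly_Mapping.single j (1::int)) (1::int))"
    by (rule arg_cong)
  then have "Poly_Mapping.single i (1::int) = Poly_Mapping.single j 1"
    by simp
  then have "Poly_Mapping.keys (Poly_Mapping.single i (1::int)) = Poly_Mapping.keys (Poly_Mapping.single j (1::int))"
    by (rule arg_cong)
  then show "i = j" by simp
qed

lemma to_fract_e_exp_root: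
  "to_fract (e_exp (root_vec i j)) = to_fract (e_eps i) / to_fract (e_eps j)"
proof -
  have "e_exp (root_vec i j) * e_eps j = e_eps i"
    unfolding e_eps_def e_exp_add[symmetric] by (simp add: root_vec_def)
  then have "to_fract (e_exp (root_vec i j)) * to_fract (e_eps j) = to_fract (e_eps i)"
    by (simp flip: to_fract_mult)
  then show ?thesis by (simp add: eq_divide_eq e_eps_nonzero)
qed

lemma to_fract_weight_factor:
  assumes "coeff2 a 0 0 = 0"
  shows "to_fract (weight_factor a i j) =
    (1 - to_fract a * to_fract tvar * (to_fract (e_eps i) / to_fract (e_eps j))) *
      (1 - to_fract (e_eps i) / to_fract (e_eps j)) /
    ((1 - to_fract a * (to_fract (e_eps i) / to_fract (e_eps j))) *
      (1 - to_fract tvar * (to_fract (e_eps i) / to_fract (e_eps j))))"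
  unfolding weight_factor_def to_fract_quot2[OF weight_factor_denom[OF assms]]
  by (simp only: to_fract_mult to_fract_diff to_fract_1 to_fract_e_exp_root)

text \<open>This is \<open>offdiag_identity\<close> at the variables \<open>e_eps i\<close> in the
  fraction field, pulled back along the injection \<open>to_fract\<close>.\<close>

lemma weight_factor_identity:
  assumes fin: "finite N" and ne: "N \<noteq> {}" and a: "coeff2 a 0 0 = 0"
  shows "(\<Sum>B\<in>Pow N. (- 1) ^ card B * tvar ^ (card B choose 2) * (1 - a ^ card N * tvar ^ card B) *
    ((1 - a) ^ card B * (1 - a * tvar) ^ card (N - B)) *
    (offdiag_prod B (weight_factor 0) * offdiag_prod (N - B) (weight_factor a) *
      (\<Prod>i\<in>B. \<Prod>j\<in>N - B. weight_factor a j i))) = 0" (is "?s = 0")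
proof -
  let ?x = "\<lambda>i. to_fract (e_eps i)" and ?t = "to_fract tvar :: (weight \<Rightarrow>\<^sub>0 int) fps2 fract"
  have nz: "?x k - to_fract c * ?x i \<noteq> 0" if "coeff2 c 0 0 = 0" for c i k
    unfolding to_fract_mult[symmetric] to_fract_diff[symmetric]
    using e_eps_diff_nonzero[OF that] by (simp only: to_fract_eq_0_iff not_False_eq_True)
  have off: "to_fract (offdiag_prod M f) = offdiag_prod M (\<lambda>i j. to_fract (f i j))"
    for M and f :: "nat \<Rightarrow> nat \<Rightarrow> (weight \<Rightarrow>\<^sub>0 int) fps2"
    by (simp add: offdiag_prod_def to_fract_hom.hom_prod)
  have z: "coeff2 0 0 0 = (0 :: weight \<Rightarrow>\<^sub>0 int)" by simp
  have "to_fract ?s = 0"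
    unfolding to_fract_hom.hom_sum to_fract_mult to_fract_hom.hom_prod off
      to_fract_weight_factor[OF a] to_fract_weight_factor[OF z] to_fract_0
      to_fract_hom.hom_power to_fract_diff to_fract_1 to_fract_uminus
  proof (rule offdiag_identity[OF fin ne])
    show "inj_on ?x N"
      by (auto simp: inj_on_def dest: e_eps_inj)
    show "?x i \<noteq> 0" for i by (simp add: e_eps_nonzero)
    show "?x k - to_fract a * ?t * ?x i \<noteq> 0" for i k
      using nz[of "a * tvar"] by (simp add: coeff2_00_mult)
    show "?x k - to_fract a * ?x i \<noteq> 0" "?x k - ?t * ?x i \<noteq> 0" for i k
      by (rule nz, simp add: a)+
  qed
  then show ?thesis by (simp only: to_fract_eq_0_iff)
qed

lemma supp2_uminus: "F \<in> supp2 S \<Longrightarrow> - F \<in> supp2 S"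
  by (simp add: supp2_def coeff2_def)

lemma CT_uminus: "CT (- F) = - CT F"
  using CT_diff[of 0 F] by (simp add: CT_0)

text \<open>The scalars carry no exponentials and leave \<open>CT\<close>. The cross factors involve
  roots of degree 1 on \<open>N - B\<close>, while the two weight products have degree 0 there and
  disjoint variables; \<open>CT_factor\<close> removes the cross factors.\<close>

lemma CT_weight_factor_identity:
  assumes fin: "finite N" and ne: "N \<noteq> {}" and a0: "coeff2 a 0 0 = 0" and a: "a \<in> supp2 {0}"
  shows "(\<Sum>B\<in>Pow N. (- 1) ^ card B * tvar ^ (card B choose 2) * (1 - CT a ^ card N * tvar ^ card B) *
    ((1 - CT a) ^ card B * (1 - CT a * tvar) ^ card (N - B)) *
    (CT (offdiag_prod B (weight_factor 0)) * CT (offdiag_prod (N - B) (weight_factor a)))) = 0"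
proof -
  let ?c = "\<lambda>B. (- 1) ^ card B * tvar ^ (card B choose 2) * (1 - a ^ card N * tvar ^ card B) *
    ((1 - a) ^ card B * (1 - a * tvar) ^ card (N - B))"
  note mem = supp2_times[OF submonoid_0] supp2_power[OF submonoid_0] supp2_diff supp2_uminus
    supp2_one[OF submonoid_0] supp2_tvar[OF submonoid_0] a
  have c: "?c B \<in> supp2 {0}" for B by (intro mem)
  have CTc: "CT (?c B) = (- 1) ^ card B * tvar ^ (card B choose 2) * (1 - CT a ^ card N * tvar ^ card B) *
    ((1 - CT a) ^ card B * (1 - CT a * tvar) ^ card (N - B))" for B
    by (simp only: CT_mult_const CT_power_const CT_diff CT_uminus CT_1 CT_tvar mem)
  have factor: "CT (offdiag_prod B (weight_factor 0) * offdiag_prod (N - B) (weight_factor a) *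
      (\<Prod>i\<in>B. \<Prod>j\<in>N - B. weight_factor a j i)) =
      CT (offdiag_prod B (weight_factor 0)) * CT (offdiag_prod (N - B) (weight_factor a))"
    if B: "B \<subseteq> N" for B
  proof (rule CT_factor[of B "N - B"])
    let ?A = "N - B"
    let ?S = "{w :: weight. Poly_Mapping.keys w \<subseteq> B}"
    let ?T = "{w. Poly_Mapping.keys w \<subseteq> ?A \<and> degree_on ?A w = 0}"
    show "finite B" "finite ?A" using fin B finite_subset by auto
    show "?A \<inter> B = {}" by auto
    have keys_root: "Poly_Mapping.keys (root_vec i j) \<subseteq> M" if "i \<in> M" "j \<in> M" for i j M
      unfolding root_vec_def using that by (intro keys_diff_subset) simp_all
    have S: "add_submonoid ?S"
      unfolding add_submonoid_def using keys_add_subset by auto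
    have T: "add_submonoid ?T"
      unfolding add_submonoid_def using keys_add_subset by (auto simp: degree_on_add) (simp add: degree_on_def)
    have 0: "0 \<in> supp2 ?S" by (simp add: supp2_def coeff2_def)
    show "offdiag_prod B (weight_factor 0) \<in> supp2 ?S"
      unfolding offdiag_prod_def
      by (intro supp2_prod[OF S] weight_factor_supp2[OF S 0]) (auto intro: keys_root[THEN subsetD])
    have a': "a \<in> supp2 ?T" using a by (rule supp2_mono) (simp add: degree_on_def)
    show "offdiag_prod ?A (weight_factor a) \<in> supp2 ?T"
      unfolding offdiag_prod_def
    proof (intro supp2_prod[OF T] weight_factor_supp2[OF T a'])
      fix i j assume "i \<in> ?A" "j \<in> ?A - {i}"
      then show "root_vec i j \<in> ?T"
        using keys_root[of i ?A j] \<open>finite ?A\<close> by (simp add: degree_on_root)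
    qed
    let ?P = "{w. 1 \<le> degree_on ?A w}"
    have P: "v + w \<in> ?P" if "v \<in> ?P" "w \<in> ?P" for v w
      using that by (simp add: degree_on_add)
    show "(\<Prod>i\<in>B. \<Prod>j\<in>?A. weight_factor a j i) - 1 \<in> supp2 ?P"
      by (intro prod_minus_1_supp2[OF P] weight_factor_minus_1[OF a a0 \<open>finite ?A\<close>]) auto
  qed
  have "0 = CT (\<Sum>B\<in>Pow N. ?c B *
    (offdiag_prod B (weight_factor 0) * offdiag_prod (N - B) (weight_factor a) *
      (\<Prod>i\<in>B. \<Prod>j\<in>N - B. weight_factor a j i)))"
    unfolding weight_factor_identity[OF fin ne a0] by (rule CT_0[symmetric])
  also have "\<dots> = (\<Sum>B\<in>Pow N. CT (?c B) *
    (CT (offdiag_prod B (weight_factor 0)) * CT (offdiag_prod (N - B) (weight_factor a))))"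
    unfolding CT_sum CT_mult_const[OF c] by (rule sum.cong) (simp_all add: factor)
  finally show ?thesis unfolding CTc by (rule sym)
qed

section \<open>Solving the recursions\<close>

lemma sum_Pow_card:
  fixes f :: "nat \<Rightarrow> 'a::comm_semiring_1"
  assumes "finite N"
  shows "(\<Sum>B\<in>Pow N. f (card B)) = (\<Sum>r\<le>card N. of_nat (card N choose r) * f r)"
proof -
  have "(\<Sum>B\<in>Pow N. f (card B)) = (\<Sum>r\<le>card N. \<Sum>B\<in>{B \<in> Pow N. card B = r}. f (card B))"
    using assms by (intro sum.group[symmetric]) (auto intro: card_mono)
  also have "\<dots> = (\<Sum>r\<le>card N. of_nat (card N choose r) * f r)"
  proof (rule sum.cong[OF refl])
    fix r
    have "(\<Sum>B\<in>{B \<in> Pow N. card B = r}. f (card B)) = (\<Sum>B\<in>{B. B \<subseteq> N \<and> card B = r}. f r)"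
      by (rule sum.cong) auto
    then show "(\<Sum>B\<in>{B \<in> Pow N. card B = r}. f (card B)) = of_nat (card N choose r) * f r"
      by (simp add: n_subsets[OF assms])
  qed
  finally show ?thesis .
qed

text \<open>The value to be proved for the constant terms: \<open>a = q\<close> belongs to the full
  weight and \<open>a = 0\<close> to the Hall-Littlewood weight.\<close>

definition ct_value :: "'a::field \<Rightarrow> 'a \<Rightarrow> nat \<Rightarrow> 'a" where
  "ct_value a t n = of_nat (fact n) * ((1 - a) * (1 - t) / (1 - a * t)) ^ n * fps_nth (hseries a t) n"

text \<open>The powers combine to \<open>((1 - a) * (1 - t)) ^ n\<close>, the number of sets
  \<open>B\<close> of size \<open>r\<close> completes \<open>fact r * fact (n - r)\<close> to
  \<open>fact n\<close>, and what remains is \<open>hseries_rec\<close>.\<close>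

lemma ct_value_rec:
  fixes a t :: "'a::field"
  assumes fin: "finite N" and a: "\<And>k. k > 0 \<Longrightarrow> a ^ k \<noteq> 1" and t: "\<And>k. k > 0 \<Longrightarrow> t ^ k \<noteq> 1"
    and at: "1 - a * t \<noteq> 0"
  shows "(\<Sum>B\<in>Pow N. (- 1) ^ card B * t ^ (card B choose 2) * (1 - a ^ card N * t ^ card B) *
    ((1 - a) ^ card B * (1 - a * t) ^ card (N - B)) * (ct_value 0 t (card B) * ct_value a t (card (N - B)))) = 0"
proof -
  define n where "n = card N"
  let ?g = "\<lambda>r. (- 1) ^ r * t ^ (r choose 2) / qfact t r * (1 - a ^ n * t ^ r) * fps_nth (hseries a t) (n - r)"
  let ?K = "((1 - a) * (1 - t)) ^ n"
  let ?f = "\<lambda>r. of_nat (fact r * fact (n - r)) * (?K * ?g r)"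
  have "(\<Sum>B\<in>Pow N. (- 1) ^ card B * t ^ (card B choose 2) * (1 - a ^ card N * t ^ card B) *
    ((1 - a) ^ card B * (1 - a * t) ^ card (N - B)) * (ct_value 0 t (card B) * ct_value a t (card (N - B)))) =
    (\<Sum>B\<in>Pow N. ?f (card B))"
  proof (rule sum.cong[OF refl])
    fix B assume "B \<in> Pow N"
    then have B: "B \<subseteq> N" by simp
    define r where "r = card B"
    have r: "r \<le> n" and nr: "card (N - B) = n - r"
      using B fin by (auto simp: r_def n_def card_mono card_Diff_subset finite_subset)
    have K: "?K = (1 - a) ^ r * (1 - t) ^ r * ((1 - a * t) ^ (n - r) * ((1 - a) * (1 - t) / (1 - a * t)) ^ (n - r))"
    proof -
      have "?K = ((1 - a) * (1 - t)) ^ r * ((1 - a) * (1 - t)) ^ (n - r)"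
        using r by (simp flip: power_add)
      then show ?thesis using at by (simp add: power_mult_distrib power_divide)
    qed
    have v0: "ct_value 0 t r = of_nat (fact r) * (1 - t) ^ r * (1 / qfact t r)"
      by (simp add: ct_value_def hseries_at_0)
    show "(- 1) ^ card B * t ^ (card B choose 2) * (1 - a ^ card N * t ^ card B) *
      ((1 - a) ^ card B * (1 - a * t) ^ card (N - B)) * (ct_value 0 t (card B) * ct_value a t (card (N - B))) =
      ?f (card B)"
      unfolding nr r_def[symmetric] n_def[symmetric] K v0 ct_value_def[of a] of_nat_mult
      by (simp only: divide_inverse mult_1_left ac_simps)
  qed
  also have "\<dots> = (\<Sum>r\<le>n. of_nat (n choose r) * ?f r)"
    unfolding n_def by (rule sum_Pow_card[OF fin])
  also have "\<dots> = (\<Sum>r\<le>n. of_nat (fact n) * ?K * ?g r)"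
  proof (rule sum.cong[OF refl])
    fix r assume "r \<in> {..n}"
    then have "fact r * fact (n - r) * (n choose r) = fact n"
      by (intro binomial_fact_lemma) simp
    then have e: "of_nat (n choose r) * of_nat (fact r * fact (n - r)) = (of_nat (fact n) :: 'a)"
      by (simp only: of_nat_mult[symmetric] mult.commute)
    show "of_nat (n choose r) * ?f r = of_nat (fact n) * ?K * ?g r"
      unfolding e[symmetric] by (simp only: mult.assoc)
  qed
  also have "\<dots> = of_nat (fact n) * ?K * (\<Sum>r\<le>n. ?g r)"
    by (rule sum_distrib_left[symmetric])
  also have "(\<Sum>r\<le>n. ?g r) = 0"
    by (rule hseries_rec[OF a t])
  also have "of_nat (fact n) * ?K * 0 = 0"
    by (rule mult_zero_right)
  finally show ?thesis .
qed

lemma offdiag_prod_empty: "offdiag_prod {} f = 1"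
  by (simp add: offdiag_prod_def)

lemma offdiag_prod_singleton: "offdiag_prod {i} f = 1"
  by (simp add: offdiag_prod_def)

abbreviation "ct_prod a N \<equiv> to_fract (CT (offdiag_prod N (weight_factor a)))"

text \<open>The constant coefficient of \<open>v ^ k\<close> is 0.\<close>

lemma to_fract_var_power:
  fixes v :: "int fps2"
  assumes "coeff2 v 0 0 = 0" "k > 0"
  shows "to_fract v ^ k \<noteq> 1"
proof
  assume "to_fract v ^ k = 1"
  then have "to_fract (v ^ k) = to_fract 1"
    by (simp only: to_fract_hom.hom_power to_fract_1)
  then have "v ^ k = 1" by (simp only: to_fract_eq_iff)
  then have "coeff2 (v ^ k) 0 0 = 1" by simp
  then show False by (simp add: coeff2_00_power assms(1) zero_power[OF assms(2)])
qed

context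
  fixes q t :: "int fps2 fract"
  defines "q \<equiv> to_fract qvar" and "t \<equiv> to_fract tvar"
begin

lemma q_power: "k > 0 \<Longrightarrow> q ^ k \<noteq> 1"
  unfolding q_def by (rule to_fract_var_power) simp_all

lemma t_power: "k > 0 \<Longrightarrow> t ^ k \<noteq> 1"
  unfolding t_def by (rule to_fract_var_power) simp_all

lemma qt_neq_1: "1 - q * t \<noteq> 0"
  using to_fract_var_power[of "qvar * tvar" 1] by (simp add: q_def t_def coeff2_00_mult)

lemma ct_prod_rec:
  assumes "finite N" "N \<noteq> {}" "coeff2 a 0 0 = 0" "a \<in> supp2 {0}"
  defines "b \<equiv> to_fract (CT a)"
  shows "(\<Sum>B\<in>Pow N. (- 1) ^ card B * t ^ (card B choose 2) * (1 - b ^ card N * t ^ card B) *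
    ((1 - b) ^ card B * (1 - b * t) ^ card (N - B)) * (ct_prod 0 B * ct_prod a (N - B))) = 0"
  using arg_cong[OF CT_weight_factor_identity[OF assms(1-4)], of to_fract]
  unfolding to_fract_hom.hom_sum to_fract_mult to_fract_hom.hom_power to_fract_diff to_fract_1
    to_fract_uminus to_fract_0 b_def t_def .

lemma ct_value_0: "ct_value a t 0 = 1"
  by (simp add: ct_value_def hseries_def qexp_def qfact_def)

text \<open>Both sides satisfy the same recursion, taken at \<open>a = 0\<close>. By induction the
  terms with \<open>B\<close> nonempty and proper agree, so only \<open>B = {}\<close> and
  \<open>B = N\<close> remain, both containing the unknown value.\<close>

lemma ct_prod_HL:
  assumes "finite N"
  shows "ct_prod 0 N = ct_value 0 t (card N)"
  using assms
proof (induction N rule: finite_psubset_induct)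
  case (psubset N)
  define n where "n = card N"
  \<comment> \<open>For \<open>n = 1\<close> the coefficient
    \<open>1 + (- 1) ^ n * t ^ (n choose 2)\<close> vanishes and the recursion says nothing, so this
    value is computed directly.\<close>
  consider "n = 0" | "n = 1" | "n \<ge> 2" by linarith
  then show ?case
  proof cases
    case 1
    then have "N = {}" using psubset by (simp add: n_def)
    then show ?thesis by (simp add: offdiag_prod_empty CT_1 ct_value_0)
  next
    case 2
    then obtain i where "N = {i}" by (auto simp: n_def card_1_singleton_iff)
    then show ?thesis
      using t_power[of 1] by (simp add: offdiag_prod_singleton CT_1 ct_value_def hseries_at_0 qfact_def)
  next
    case 3
    then have ne: "N \<noteq> {}" and z: "(0 :: int fps2 fract) ^ n = 0"
      by (auto simp: n_def zero_power)
    let ?c = "\<lambda>B. (- 1) ^ card B * t ^ (card B choose 2) * (1 - 0 ^ n * t ^ card B) *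
      ((1 - 0) ^ card B * (1 - 0 * t) ^ card (N - B))"
    have 1: "(\<Sum>B\<in>Pow N. ?c B * (ct_prod 0 B * ct_prod 0 (N - B))) = 0"
      using ct_prod_rec[of N 0, OF psubset.hyps ne] by (simp add: n_def CT_0 supp2_def coeff2_def)
    have 2: "(\<Sum>B\<in>Pow N. ?c B * (ct_value 0 t (card B) * ct_value 0 t (card (N - B)))) = 0"
      unfolding n_def by (rule ct_value_rec[OF psubset.hyps]) (simp_all add: t_power zero_power)
    let ?d = "\<lambda>B. ?c B * (ct_prod 0 B * ct_prod 0 (N - B) - ct_value 0 t (card B) * ct_value 0 t (card (N - B)))"
    have "0 = (\<Sum>B\<in>Pow N. ?c B * (ct_prod 0 B * ct_prod 0 (N - B))) -
        (\<Sum>B\<in>Pow N. ?c B * (ct_value 0 t (card B) * ct_value 0 t (card (N - B))))"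
      unfolding 1 2 by simp
    also have "\<dots> = (\<Sum>B\<in>Pow N. ?d B)"
      unfolding sum_subtractf[symmetric] by (rule sum.cong[OF refl], rule right_diff_distrib[symmetric])
    also have "\<dots> = (\<Sum>B\<in>{{}, N}. ?d B)"
    proof (rule sum.mono_neutral_right)
      show "\<forall>B\<in>Pow N - {{}, N}. ?d B = 0"
      proof
        fix B assume "B \<in> Pow N - {{}, N}"
        then have "B \<subset> N" "N - B \<subset> N" by auto
        then show "?d B = 0" using psubset.IH by simp
      qed
    qed (use psubset.hyps in auto)
    also have "\<dots> = (1 + (- 1) ^ n * t ^ (n choose 2)) * (ct_prod 0 N - ct_value 0 t n)"
      unfolding z using ne by (simp add: offdiag_prod_empty CT_1 ct_value_0 n_def[symmetric] numeral_2_eq_2 algebra_simps)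
    finally have "(1 + (- 1) ^ n * t ^ (n choose 2)) * (ct_prod 0 N - ct_value 0 t n) = 0" by simp
    \<comment> \<open>Otherwise squaring would make a positive power of \<open>t\<close> equal to
      1.\<close>
    moreover have "1 + (- 1) ^ n * t ^ (n choose 2) \<noteq> 0"
    proof
      assume "1 + (- 1) ^ n * t ^ (n choose 2) = 0"
      then have "(- 1) ^ n * t ^ (n choose 2) = - 1" by (simp add: add_eq_0_iff)
      then have "((- 1) ^ n * t ^ (n choose 2)) ^ 2 = 1" by simp
      then have "t ^ (2 * (n choose 2)) = 1"
        by (simp add: power_mult_distrib mult.commute flip: power_mult)
      moreover have "2 * (n choose 2) > 0" using 3 by (simp add: zero_less_binomial_iff)
      ultimately show False using t_power by blast
    qed
    ultimately show ?thesis by (simp add: n_def)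
  qed
qed

text \<open>The factor at \<open>B\<close> is known from \<open>ct_prod_HL\<close>, and the one at
  \<open>N - B\<close> by induction unless \<open>B = {}\<close>. That single term has the nonzero
  coefficient \<open>(1 - q ^ n) * (1 - q * t) ^ n\<close>.\<close>

lemma ct_prod_eq:
  assumes "finite N"
  shows "ct_prod qvar N = ct_value q t (card N)"
  using assms
proof (induction N rule: finite_psubset_induct)
  case (psubset N)
  define n where "n = card N"
  show ?case
  proof (cases "N = {}")
    case True
    then show ?thesis by (simp add: offdiag_prod_empty CT_1 ct_value_0)
  next
    case False
    then have n: "n > 0" using psubset by (simp add: n_def card_gt_0_iff)
    let ?c = "\<lambda>B. (- 1) ^ card B * t ^ (card B choose 2) * (1 - q ^ n * t ^ card B) *
      ((1 - q) ^ card B * (1 - q * t) ^ card (N - B))"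
    have 1: "(\<Sum>B\<in>Pow N. ?c B * (ct_prod 0 B * ct_prod qvar (N - B))) = 0"
      using ct_prod_rec[of N qvar, OF psubset.hyps False _ supp2_qvar[OF submonoid_0]]
      by (simp add: n_def CT_qvar q_def)
    have 2: "(\<Sum>B\<in>Pow N. ?c B * (ct_value 0 t (card B) * ct_value q t (card (N - B)))) = 0"
      unfolding n_def by (rule ct_value_rec[OF psubset.hyps]) (use q_power t_power qt_neq_1 in blast)+
    let ?d = "\<lambda>B. ?c B * (ct_prod 0 B * ct_prod qvar (N - B) - ct_value 0 t (card B) * ct_value q t (card (N - B)))"
    have "0 = (\<Sum>B\<in>Pow N. ?c B * (ct_prod 0 B * ct_prod qvar (N - B))) -
        (\<Sum>B\<in>Pow N. ?c B * (ct_value 0 t (card B) * ct_value q t (card (N - B))))"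
      unfolding 1 2 by simp
    also have "\<dots> = (\<Sum>B\<in>Pow N. ?d B)"
      unfolding sum_subtractf[symmetric] by (rule sum.cong[OF refl], rule right_diff_distrib[symmetric])
    also have "\<dots> = (\<Sum>B\<in>{{}}. ?d B)"
    proof (rule sum.mono_neutral_right)
      show "\<forall>B\<in>Pow N - {{}}. ?d B = 0"
      proof
        fix B assume "B \<in> Pow N - {{}}"
        then have "N - B \<subset> N" "finite B" using psubset.hyps finite_subset by auto
        then show "?d B = 0" using psubset.IH ct_prod_HL by simp
      qed
    qed (use psubset.hyps in auto)
    also have "\<dots> = (1 - q ^ n) * (1 - q * t) ^ n * (ct_prod qvar N - ct_value q t n)"
      by (simp add: offdiag_prod_empty CT_1 ct_value_0 n_def[symmetric] numeral_2_eq_2)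
    finally have "(1 - q ^ n) * (1 - q * t) ^ n * (ct_prod qvar N - ct_value q t n) = 0" by simp
    then show ?thesis using q_power[OF n] qt_neq_1 by (simp add: n_def)
  qed
qed

text \<open>Each \<open>refl_det\<close> is a \<open>cyc_det\<close> divided by
  \<open>1 - z\<close>; the divisors for \<open>z\<close> equal to \<open>q * t\<close>,
  \<open>q\<close> and \<open>t\<close> collect into the prefactor.\<close>

lemma to_fract_refl_det_quot:
  assumes w: "w \<in> weyl_group n" and n: "n \<ge> 1"
  shows "to_fract (quot2 (refl_det n (qvar * tvar) w) (refl_det n qvar w * refl_det n tvar w)) =
    (1 - q) * (1 - t) / (1 - q * t) * cyc_ratio q t n w (\<lambda>_. 1)"
proof -
  have c: "to_fract (cyc_det n w (\<lambda>_. z)) = cyc_det n w (\<lambda>_. to_fract z)" for z :: "int fps2"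
  proof -
    let ?M = "mat n n (\<lambda>(i, j). of_bool (i = j) - z * of_bool (j = w i))"
    have "to_fract (det ?M) = det (map_mat to_fract ?M)"
      by (simp add: to_fract_hom.hom_det)
    also have "map_mat to_fract ?M = mat n n (\<lambda>(i, j). of_bool (i = j) - to_fract z * of_bool (j = w i))"
      by (rule eq_matI) auto
    finally show ?thesis by (simp add: cyc_det_def)
  qed
  have r: "to_fract (refl_det n z w) = cyc_det n w (\<lambda>_. to_fract z) / (1 - to_fract z)"
    if "coeff2 z 0 0 = 0" for z
  proof -
    have "(1 - to_fract z) * to_fract (refl_det n z w) = cyc_det n w (\<lambda>_. to_fract z)"
      unfolding c[symmetric] refl_det_cyc_det[OF w n, symmetric] by simp
    moreover have "1 - to_fract z \<noteq> 0" using to_fract_var_power[OF that, of 1] by simp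
    ultimately show ?thesis by (simp add: eq_divide_eq mult.commute)
  qed
  have one: "coeff2 (refl_det n qvar w * refl_det n tvar w) 0 0 = 1"
    by (simp add: coeff2_00_mult refl_det_const_coeff[OF w])
  have "coeff2 (qvar * tvar :: int fps2) 0 0 = 0" by (simp add: coeff2_00_mult)
  then show ?thesis
    unfolding to_fract_quot2[OF one] to_fract_mult
    by (simp add: r cyc_ratio_def q_def t_def)
qed

end

section \<open>From ordered pairs to the root system\<close>

lemma root_vec_inj:
  assumes "root_vec i j = root_vec k l" "i \<noteq> j" "k \<noteq> l"
  shows "i = k \<and> j = l"
proof -
  have lk: "Poly_Mapping.lookup (root_vec i j) m = of_bool (m = i) - of_bool (m = j)" for i j m
    by (auto simp: root_vec_def lookup_minus lookup_single when_def)
  have "of_bool (m = i) - of_bool (m = j) = (of_bool (m = k) - of_bool (m = l) :: int)" for m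
    unfolding lk[symmetric] assms(1) ..
  from this[of i] this[of j] show ?thesis
    using assms(2,3) by (auto split: if_splits simp: of_bool_def)
qed

text \<open>Distinct ordered pairs give distinct roots, so nothing is lost in passing to the set of
  roots.\<close>

lemma root_system_prod:
  "(\<Prod>\<alpha>\<in>root_system n. f \<alpha>) = offdiag_prod {..<n} (\<lambda>i j. f (root_vec i j))"
proof -
  let ?D = "SIGMA i:{..<n}. {..<n} - {i}"
  have inj: "inj_on (\<lambda>(i, j). root_vec i j) ?D"
    by (auto simp: inj_on_def dest: root_vec_inj)
  have "root_system n = (\<lambda>(i, j). root_vec i j) ` ?D"
    by (force simp: root_system_def root_vec_def)
  then have "(\<Prod>\<alpha>\<in>root_system n. f \<alpha>) = (\<Prod>(i, j)\<in>?D. f (root_vec i j))"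
    by (simp only: prod.reindex[OF inj] o_def) (simp only: case_prod_unfold)
  also have "\<dots> = (\<Prod>i<n. \<Prod>j\<in>{..<n} - {i}. f (root_vec i j))"
    by (rule prod.Sigma[symmetric]) auto
  finally show ?thesis by (simp add: offdiag_prod_def)
qed

theorem corollary8p2:
  fixes n :: nat
  assumes "n \<ge> 2"
  shows "quot2 ((1 - qvar * tvar) ^ (n - 1)) ((1 - qvar) ^ (n - 1) * (1 - tvar) ^ (n - 1)) *
      CT (\<Prod>\<alpha>\<in>root_system n.
        quot2 ((1 - qvar * tvar * e_exp \<alpha>) * (1 - e_exp \<alpha>))
              ((1 - qvar * e_exp \<alpha>) * (1 - tvar * e_exp \<alpha>)))
    = (\<Sum>w\<in>weyl_group n.
        quot2 (refl_det n (qvar * tvar) w) (refl_det n qvar w * refl_det n tvar w))"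
    (is "?q * CT ?p = ?r")
proof -
  define q t :: "int fps2 fract" where "q = to_fract qvar" and "t = to_fract tvar"
  have q: "1 - q \<noteq> 0" and t: "1 - t \<noteq> 0" and qt: "1 - q * t \<noteq> 0"
    using q_power[of 1] t_power[of 1] qt_neq_1 by (simp_all add: q_def t_def)
  obtain m where n: "n = Suc m" using assms by (cases n) auto
  let ?h = "of_nat (fact n) * fps_nth (hseries q t) n"
  have "?p = offdiag_prod {..<n} (weight_factor qvar)"
    unfolding root_system_prod weight_factor_def ..
  then have "to_fract (CT ?p) = ((1 - q) * (1 - t) / (1 - q * t)) ^ n * ?h"
    using ct_prod_eq[of "{..<n}"] by (simp add: ct_value_def q_def t_def)
  moreover have "to_fract ?q = (1 - q * t) ^ m / ((1 - q) ^ m * (1 - t) ^ m)"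
    by (subst to_fract_quot2)
      (simp_all add: coeff2_00_mult coeff2_00_power q_def t_def n to_fract_hom.hom_power)
  \<comment> \<open>The constant term brings the power \<open>n\<close> of
    \<open>(1 - q) * (1 - t) / (1 - q * t)\<close> and \<open>?q\<close> the inverse of its power
    \<open>n - 1\<close>. The one factor left is the prefactor in
    \<open>to_fract_refl_det_quot\<close>.\<close>
  ultimately have "to_fract (?q * CT ?p) = (1 - q) * (1 - t) / (1 - q * t) * ?h"
    using q t qt by (simp add: n power_divide power_mult_distrib)
  also have "?h = cyc_sum q t n (\<lambda>_. 1)"
    unfolding q_def t_def by (rule cyc_sum_eq[OF q_power t_power, symmetric])
  also have "(1 - q) * (1 - t) / (1 - q * t) * \<dots> = to_fract ?r"
    unfolding cyc_sum_def to_fract_hom.hom_sum sum_distrib_left weyl_group_def q_def t_def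
    by (rule sum.cong) (use n in \<open>simp_all add: to_fract_refl_det_quot weyl_group_def\<close>)
  finally show ?thesis by (simp only: to_fract_eq_iff)
qed

end
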